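(* Let $\mathcal T$ be a planar or toric trinity, let $\Delta$ be a black triangle of $\mathcal T$, and let $\mathcal T_0$ be a planar trinity. Every state of the connected sum $\mathcal T\#\mathcal T_0$ (formed by gluing $\mathcal T_0$ into $\Delta$) restricts to a state $s$ of $\mathcal T$ (a matching of the white triangles and vertices coming from $\mathcal T$) and a state $s'$ of $\mathcal T_0$ (a matching of the non-outer white triangles and non-root vertices of $\mathcal T_0$). The map sending a state to the pair $(s,s')$ is a bijection onto the set of pairs (state of $\mathcal T$, state of $\mathcal T_0$). Under this identification, there is a clockwise move from $(s,s')$ to $(t,t')$ if and only if either $s'=t'$ and there is a clockwise move from $s$ to $t$ in $\mathcal T$, or $s=t$ and there is a clockwise move from $s'$ to $t'$ in $\mathcal T_0$. In other words, the state transition graph of $\mathcal T\#\mathcal T_0$ is the Cartesian product of the state transition graphs of $\mathcal T$ and $\mathcal T_0$.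
   Context: A trinity is a triangulation $\mathcal T$ of a compact connected oriented closed surface $\Sigma$ whose vertices are colored red, green, blue so that the endpoints of every edge have different colors (so each triangle has one vertex of each color). A triangle is black if its vertices, read clockwise (with respect to the orientation of $\Sigma$), appear in the cyclic order blue, green, red; otherwise it is white. A toric trinity is a trinity on the torus. A planar trinity is a trinity on $S^2$ together with a chosen white triangle called outer; its three vertices are called roots. A state (Tutte matching) of a toric trinity is a bijection between the set of white triangles and the set of vertices matching each white triangle with one of its own vertices; for a planar trinity it is such a bijection between non-outer white triangles and non-root vertices. Clock moves: let $D\subset\Sigma$ be a closed disk that is a union of triangles of $\mathcal T$, whose boundary is a cycle of three edges with vertices $u_1,u_2,u_3$ listed in clockwise order around $D$, and such that for $i=1,2,3$ (indices mod 3) the triangle $W_i$ not contained in $D$ containing the edge $u_iu_{i+1}$ is white. A state is clockwise at $D$ if it matches $W_i$ with $u_{i+1}$ for all $i$, and counter-clockwise at $D$ if it matches $W_i$ with $u_i$ for all $i$. The clockwise move about $D$ turns a state clockwise at $D$ into the state obtained by replacing the pairs $(W_i,u_{i+1})$ by $(W_i,u_i)$, leaving all other pairs unchanged; the inverse is the counter-clockwise move about $D$. The state transition graph has the states as vertices and a directed edge $s\to t$ whenever $t$ is obtained from $s$ by a clockwise move. Connected sum: given a trinity $\mathcal T$ (planar or toric), a black triangle $\Delta$ of $\mathcal T$ and a planar trinity $\mathcal T_0$, the trinity $\mathcal T\#\mathcal T_0$ is obtained by removing the interior of $\Delta$ and gluing in $\mathcal T_0$ minus the interior of its outer triangle, identifying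 the two triangular boundaries in the unique way matching vertex colors. It lies on the same surface as $\mathcal T$ (and is planar with the same outer triangle when $\mathcal T$ is planar); the roots of $\mathcal T_0$ become the vertices of $\Delta$. *)

theory Defs
  imports "Graph_Theory.Digraph_Isomorphism" "Graph_Theory.Pair_Digraph"
begin

section \<open>Trinities\<close>

datatype color = Red | Green | Blue

text \<open>
  A properly 3-coloured triangulation of a closed oriented surface, as gluing data. Every triangle
  has exactly one corner of each colour, so a side of \<open>\<tau>\<close> is named by the colour \<open>c\<close> of the opposite
  corner. Distinct edges may share both endpoints.

  \<^item> \<open>corner X \<tau> c\<close> is the vertex of \<open>\<tau>\<close> of colour \<open>c\<close>;
  \<^item> \<open>across X \<tau> c\<close> is the other triangle containing the side of \<open>\<tau>\<close> opposite \<open>c\<close>;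
  \<^item> \<open>cw X \<tau> c\<close> is the colour following \<open>c\<close> when the corners of \<open>\<tau>\<close> are read clockwise: these
    cyclic orders are the orientation of the surface;
  \<^item> \<open>outer X\<close> is the outer triangle, present only in planar trinities.
\<close>

record ('t, 'v) trinity_data =
  triangles :: "'t set"
  vertices :: "'v set"
  vcolor :: "'v \<Rightarrow> color"
  corner :: "'t \<Rightarrow> color \<Rightarrow> 'v"
  across :: "'t \<Rightarrow> color \<Rightarrow> 't"
  cw :: "'t \<Rightarrow> color \<Rightarrow> color"
  outer :: "'t option"

definition black_triangles :: "('t, 'v) trinity_data \<Rightarrow> 't set" where
  "black_triangles X =
    {\<tau> \<in> triangles X. cw X \<tau> Blue = Green \<and> cw X \<tau> Green = Red \<and> cw X \<tau> Red = Blue}"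

definition white_triangles :: "('t, 'v) trinity_data \<Rightarrow> 't set" where
  "white_triangles X = triangles X - black_triangles X"

definition edge_of :: "('t, 'v) trinity_data \<Rightarrow> 't \<Rightarrow> color \<Rightarrow> color \<times> 't set" where
  "edge_of X \<tau> c = (c, {\<tau>, across X \<tau> c})"

definition vertices_in :: "('t, 'v) trinity_data \<Rightarrow> 't set \<Rightarrow> 'v set" where
  "vertices_in X D = {corner X \<tau> c | \<tau> c. \<tau> \<in> D}"

definition edges_in :: "('t, 'v) trinity_data \<Rightarrow> 't set \<Rightarrow> (color \<times> 't set) set" where
  "edges_in X D = {edge_of X \<tau> c | \<tau> c. \<tau> \<in> D}"

definition euler_char :: "('t, 'v) trinity_data \<Rightarrow> 't set \<Rightarrow> int" where
  "euler_char X D = int (card (vertices_in X D)) - int (card (edges_in X D)) + int (card D)"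

definition edge_connected :: "('t, 'v) trinity_data \<Rightarrow> 't set \<Rightarrow> bool" where
  "edge_connected X D \<longleftrightarrow>
    (\<forall>\<tau>\<in>D. \<forall>\<sigma>\<in>D. (\<tau>, \<sigma>) \<in> {(\<alpha>, across X \<alpha> c) | \<alpha> c. \<alpha> \<in> D \<and> across X \<alpha> c \<in> D}\<^sup>*)"

text \<open>
  The assumption \<open>around_vertex\<close> says that the triangles at a vertex form a single cycle, i.e. that
  the glued space is a surface at its vertices; \<open>cw_cyclic\<close> makes \<open>cw X \<tau>\<close> one of the two cyclic
  orders of the three colours; \<open>cw_coherent\<close> says that the two triangles at an edge run through
  it in opposite directions.
\<close>

locale trinity =
  fixes X :: "('t, 'v) trinity_data"
  assumes finite_triangles: "finite (triangles X)"
    and triangles_nonempty: "triangles X \<noteq> {}"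
    and vertices_eq: "vertices X = vertices_in X (triangles X)"
    and vcolor_corner: "\<tau> \<in> triangles X \<Longrightarrow> vcolor X (corner X \<tau> c) = c"
    and across_closed: "\<tau> \<in> triangles X \<Longrightarrow> across X \<tau> c \<in> triangles X"
    and across_invol: "\<tau> \<in> triangles X \<Longrightarrow> across X (across X \<tau> c) c = \<tau>"
    and corner_across: "\<tau> \<in> triangles X \<Longrightarrow> d \<noteq> c \<Longrightarrow> corner X (across X \<tau> c) d = corner X \<tau> d"
    and around_vertex: "\<tau> \<in> triangles X \<Longrightarrow> \<sigma> \<in> triangles X \<Longrightarrow> corner X \<tau> d = corner X \<sigma> d \<Longrightarrow>
      (\<tau>, \<sigma>) \<in> {(\<alpha>, across X \<alpha> c) | \<alpha> c. \<alpha> \<in> triangles X \<and> c \<noteq> d}\<^sup>*"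
    and cw_cyclic: "\<tau> \<in> triangles X \<Longrightarrow> cw X \<tau> c \<noteq> c \<and> cw X \<tau> (cw X \<tau> c) \<noteq> c"
    and cw_coherent: "\<tau> \<in> triangles X \<Longrightarrow> d \<noteq> c \<Longrightarrow> cw X \<tau> d \<noteq> c \<Longrightarrow>
      cw X (across X \<tau> c) (cw X \<tau> d) = d"
    and connected: "edge_connected X (triangles X)"

text \<open>
  By the classification of closed oriented connected surfaces, the Euler characteristic singles out
  the sphere and the torus.
\<close>

locale planar_trinity = trinity +
  assumes sphere: "euler_char X (triangles X) = 2"
    and outer_white: "\<exists>w \<in> white_triangles X. outer X = Some w"

locale toric_trinity = trinity +
  assumes torus: "euler_char X (triangles X) = 0"
    and no_outer: "outer X = None"

definition roots :: "('t, 'v) trinity_data \<Rightarrow> 'v set" where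
  "roots X = vertices_in X (set_option (outer X))"


section \<open>States and clock moves\<close>

text \<open>A state is the set of matched pairs (the graph of the bijection).\<close>

definition states :: "('t, 'v) trinity_data \<Rightarrow> ('t \<times> 'v) set set" where
  "states X = {M. (\<forall>(w, v) \<in> M. \<exists>c. v = corner X w c) \<and>
                  bij_betw fst M (white_triangles X - set_option (outer X)) \<and>
                  bij_betw snd M (vertices X - roots X)}"

definition boundary_sides :: "('t, 'v) trinity_data \<Rightarrow> 't set \<Rightarrow> ('t \<times> color) set" where
  "boundary_sides X D = {(\<tau>, c). \<tau> \<in> D \<and> across X \<tau> c \<notin> D}"

text \<open>
  \<open>clock_disk X D u W\<close>: the union of \<open>D\<close> is a closed disk whose boundary is the cycle of
  three edges with vertices \<open>u 0, u 1, u 2\<close> in clockwise order, and \<open>W i\<close> is the triangle outside \<open>D\<close>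
  at the edge from \<open>u i\<close> to \<open>u (i + 1)\<close>, indices mod 3; all \<open>W i\<close> are white. Since the boundary edges
  form one simple cycle, the union of \<open>D\<close> is a compact surface with one boundary circle; it is a
  disk iff it is connected of Euler characteristic 1. Clockwise around \<open>D\<close> agrees, along a boundary
  edge, with clockwise around the triangle \<open>\<sigma> i\<close> of \<open>D\<close> at that edge.
\<close>

definition clock_disk ::
  "('t, 'v) trinity_data \<Rightarrow> 't set \<Rightarrow> (nat \<Rightarrow> 'v) \<Rightarrow> (nat \<Rightarrow> 't) \<Rightarrow> bool" where
  "clock_disk X D u W \<longleftrightarrow>
    D \<subseteq> triangles X \<and> edge_connected X D \<and> euler_char X D = 1 \<and> inj_on u {..<3} \<and>
    (\<exists>\<sigma> c. boundary_sides X D = (\<lambda>i. (\<sigma> i, c i)) ` {..<3} \<and>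
      (\<forall>i<3. corner X (\<sigma> i) (cw X (\<sigma> i) (c i)) = u i \<and>
             corner X (\<sigma> i) (cw X (\<sigma> i) (cw X (\<sigma> i) (c i))) = u (Suc i mod 3) \<and>
             across X (\<sigma> i) (c i) = W i)) \<and>
    (\<forall>i<3. W i \<in> white_triangles X)"

definition cw_pairs :: "(nat \<Rightarrow> 'v) \<Rightarrow> (nat \<Rightarrow> 't) \<Rightarrow> ('t \<times> 'v) set" where
  "cw_pairs u W = (\<lambda>i. (W i, u (Suc i mod 3))) ` {..<3}"

definition ccw_pairs :: "(nat \<Rightarrow> 'v) \<Rightarrow> (nat \<Rightarrow> 't) \<Rightarrow> ('t \<times> 'v) set" where
  "ccw_pairs u W = (\<lambda>i. (W i, u i)) ` {..<3}"

definition clockwise_move ::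
  "('t, 'v) trinity_data \<Rightarrow> ('t \<times> 'v) set \<Rightarrow> ('t \<times> 'v) set \<Rightarrow> bool" where
  "clockwise_move X s t \<longleftrightarrow> s \<in> states X \<and> t \<in> states X \<and>
    (\<exists>D u W. clock_disk X D u W \<and> cw_pairs u W \<subseteq> s \<and> t = (s - cw_pairs u W) \<union> ccw_pairs u W)"

definition transition_graph :: "('t, 'v) trinity_data \<Rightarrow> ('t \<times> 'v) set pair_pre_digraph" where
  "transition_graph X = \<lparr>pverts = states X, parcs = {(s, t). clockwise_move X s t}\<rparr>"

definition cartesian_product ::
  "'a pair_pre_digraph \<Rightarrow> 'b pair_pre_digraph \<Rightarrow> ('a \<times> 'b) pair_pre_digraph" where
  "cartesian_product G H = \<lparr>pverts = pverts G \<times> pverts H,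
    parcs = {((x, y), (x', y')). (y = y' \<and> y \<in> pverts H \<and> (x, x') \<in> parcs G) \<or>
                                 (x = x' \<and> x \<in> pverts G \<and> (y, y') \<in> parcs H)}\<rparr>"


section \<open>Connected sum\<close>

text \<open>
  \<open>conn_sum X \<Delta> Y\<close> replaces the black triangle \<open>\<Delta>\<close> of \<open>X\<close> by \<open>Y\<close> minus its outer triangle \<open>\<omega>\<close>.
  The vertices of \<open>X\<close> and the non-root vertices of \<open>Y\<close> are kept apart by \<open>Inl\<close> and \<open>Inr\<close>; the
  root of \<open>Y\<close> of colour \<open>c\<close> becomes the vertex of \<open>\<Delta>\<close> of colour \<open>c\<close>, and the side of \<open>\<omega>\<close> opposite \<open>c\<close>
  is identified with that of \<open>\<Delta>\<close>.
\<close>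

definition conn_sum ::
  "('t, 'v) trinity_data \<Rightarrow> 't \<Rightarrow> ('a, 'b) trinity_data \<Rightarrow> ('t + 'a, 'v + 'b) trinity_data" where
  "conn_sum X \<Delta> Y = (let \<omega> = the (outer Y) in
    \<lparr>triangles = (triangles X - {\<Delta>}) <+> (triangles Y - {\<omega>}),
     vertices = vertices X <+> (vertices Y - roots Y),
     vcolor = case_sum (vcolor X) (vcolor Y),
     corner = case_sum
       (\<lambda>\<tau> c. Inl (corner X \<tau> c))
       (\<lambda>\<tau> c. if corner Y \<tau> c \<in> roots Y then Inl (corner X \<Delta> c) else Inr (corner Y \<tau> c)),
     across = case_sum
       (\<lambda>\<tau> c. if across X \<tau> c = \<Delta> then Inr (across Y \<omega> c) else Inl (across X \<tau> c))
       (\<lambda>\<tau> c. if across Y \<tau> c = \<omega> then Inl (across X \<Delta> c) else Inr (across Y \<tau> c)),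
     cw = case_sum (cw X) (cw Y),
     outer = map_option Inl (outer X)\<rparr>)"

definition restrict_left :: "(('t + 'a) \<times> ('v + 'b)) set \<Rightarrow> ('t \<times> 'v) set" where
  "restrict_left M = {(w, v). (Inl w, Inl v) \<in> M}"

definition restrict_right :: "(('t + 'a) \<times> ('v + 'b)) set \<Rightarrow> ('a \<times> 'b) set" where
  "restrict_right M = {(w, v). (Inr w, Inr v) \<in> M}"

end

theory Submission
  imports Defs
begin

text \<open>
  Counting via the Euler characteristic, \<open>T\<^sub>0\<close> has as many non-root vertices as non-outer white
  triangles, and in the connected sum the non-root vertices touch only triangles of \<open>T\<^sub>0\<close>. Hence every
  state splits. For a clock move about a disk \<open>D\<close>, splitting the states before and after the move shows
  that the three triangles \<open>W i\<close> and the three vertices \<open>u i\<close> come from the same summand. Since the other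
  summand minus one triangle is connected, \<open>D\<close> contains all or nothing of it; collapsing it to one
  triangle gives the disk in the summand, and this can be reversed.

  The Euler characteristic is unchanged by collapsing \<open>T\<^sub>0\<close>, a sphere. When \<open>T\<close> is a torus, it would
  change if \<open>T\<close> were collapsed to the outer triangle of \<open>T\<^sub>0\<close>, but this case does not occur: a disk in \<open>T\<^sub>0\<close>
  that contains the outer triangle admits no move by a count of white triangles and vertices, and a disk
  in the connected sum cannot contain the punctured torus \<open>T\<close>, as it would collapse to a connected set
  of triangles of Euler characteristic 3.
\<close>

section \<open>Triangulations\<close>

text \<open>The constant 3 for the torus comes from \<open>euler_char_lift\<close>: replacing one
  triangle by a block \<open>B\<close> changes the Euler characteristic by
  \<open>euler_char Z B - 1\<close>. A sphere minus a triangle has Euler characteristic 1, so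
  collapsing it changes nothing; a torus minus a triangle has -1, so a set of Euler characteristic 1
  that contains it collapses to one of 1 + 2. The bound \<open>euler_char_le_2\<close> excludes this
  for connected sets. In the other direction topology gives no help: a set of triangles around the
  outer triangle of \<open>T\<^sub>0\<close> can be a genuine disk of the sphere without becoming a
  disk of the sum. Only the matching rules it out. The black triangle \<open>\<Delta>\<close> and
  the white outer triangle play symmetric roles, so the transport of disks is proved once, in the
  locale \<open>collapse\<close>, and instantiated twice. The sum itself is never shown to satisfy
  the axioms of \<open>trinity\<close>. Whatever is known about it is read off from a summand, which
  is why connectivity and the sets of vertices and edges are first treated for arbitrary
  records.\<close>

lemma UNIV_color: "(UNIV :: color set) = {Red, Green, Blue}"
  using color.exhaust by auto

lemma finite_UNIV_color [simp]: "finite (UNIV :: color set)"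
  by (simp add: UNIV_color)

lemma card_UNIV_color [simp]: "card (UNIV :: color set) = 3"
  by (simp add: UNIV_color)

lemma other_colors: obtains d d' :: color where "d \<noteq> c" "d' \<noteq> c" "d \<noteq> d'" "UNIV = {c, d, d'}"
  by (cases c) (auto simp: UNIV_color)

text \<open>The set reachable from a triangle is closed under adjacency, and a closed set contains
  all that is reachable from it. Closed sets are easy to pull back, to lift and to intersect with a
  block, unlike paths.\<close>

lemma edge_connected_iff_cut:
  "edge_connected X D \<longleftrightarrow>
    (\<forall>A. A \<subseteq> D \<and> A \<noteq> {} \<and> (\<forall>\<alpha>\<in>A. \<forall>c. across X \<alpha> c \<in> D \<longrightarrow> across X \<alpha> c \<in> A) \<longrightarrow> A = D)"
    (is "_ = ?R")
proof
  assume *: "edge_connected X D"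
  show ?R
  proof (intro allI impI equalityI subsetI; elim conjE)
    fix A \<sigma> assume A: "A \<subseteq> D" "A \<noteq> {}"
      "\<forall>\<alpha>\<in>A. \<forall>c. across X \<alpha> c \<in> D \<longrightarrow> across X \<alpha> c \<in> A" and \<sigma>: "\<sigma> \<in> D"
    obtain \<tau> where \<tau>: "\<tau> \<in> A" using A by auto
    have "(\<tau>, \<sigma>) \<in> {(\<alpha>, across X \<alpha> c) | \<alpha> c. \<alpha> \<in> D \<and> across X \<alpha> c \<in> D}\<^sup>*"
      using * \<tau> A \<sigma> unfolding edge_connected_def by blast
    then show "\<sigma> \<in> A"
      by (induction rule: rtrancl_induct) (use \<tau> A in auto)
  qed auto
next
  assume R: ?R
  show "edge_connected X D"
    unfolding edge_connected_def
  proof (intro ballI)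
    fix \<tau> \<sigma> assume \<tau>: "\<tau> \<in> D" and \<sigma>: "\<sigma> \<in> D"
    let ?r = "{(\<alpha>, across X \<alpha> c) | \<alpha> c. \<alpha> \<in> D \<and> across X \<alpha> c \<in> D}"
    let ?A = "{\<rho> \<in> D. (\<tau>, \<rho>) \<in> ?r\<^sup>*}"
    have "\<forall>\<alpha>\<in>?A. \<forall>c. across X \<alpha> c \<in> D \<longrightarrow> across X \<alpha> c \<in> ?A"
      by (auto intro: rtrancl_into_rtrancl)
    moreover have "?A \<subseteq> D" "\<tau> \<in> ?A" using \<tau> by auto
    ultimately have "?A = D" using R by blast
    then show "(\<tau>, \<sigma>) \<in> ?r\<^sup>*" using \<sigma> by auto
  qed
qed

lemma edge_connectedD:
  assumes "edge_connected X D" "A \<subseteq> D" "A \<noteq> {}"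
    and "\<And>\<alpha> c. \<alpha> \<in> A \<Longrightarrow> across X \<alpha> c \<in> D \<Longrightarrow> across X \<alpha> c \<in> A"
  shows "A = D"
  using assms unfolding edge_connected_iff_cut by blast

text \<open>Only sides with both triangles in \<open>A\<close> have to correspond under
  \<open>f\<close>; in the sum, the sides along a removed triangle are glued differently.\<close>

lemma edge_connected_image:
  assumes "edge_connected Q A" "inj f"
    and "\<And>\<tau> c. \<tau> \<in> A \<Longrightarrow> across Q \<tau> c \<in> A \<Longrightarrow> across P (f \<tau>) c = f (across Q \<tau> c)"
  shows "edge_connected P (f ` A)"
  unfolding edge_connected_iff_cut
proof (intro allI impI; elim conjE)
  fix C assume C: "C \<subseteq> f ` A" "C \<noteq> {}"
    and cl: "\<forall>\<alpha>\<in>C. \<forall>c. across P \<alpha> c \<in> f ` A \<longrightarrow> across P \<alpha> c \<in> C"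
  have "f -` C = A"
  proof (rule edge_connectedD[OF assms(1)])
    show "f -` C \<subseteq> A" using C inj_image_mem_iff[OF assms(2)] by blast
    show "f -` C \<noteq> {}" using C by blast
    fix \<alpha> c assume *: "\<alpha> \<in> f -` C" "across Q \<alpha> c \<in> A"
    then have "\<alpha> \<in> A" using \<open>f -` C \<subseteq> A\<close> by blast
    then have "across P (f \<alpha>) c = f (across Q \<alpha> c)" using assms(3) * by blast
    then show "across Q \<alpha> c \<in> f -` C" using cl * by (metis imageI vimage_eq)
  qed
  then show "C = f ` A" using C by blast
qed

section \<open>Vertices and edges of sets of triangles\<close>

lemma vertices_in_image: "vertices_in X D = (\<lambda>(\<tau>, c). corner X \<tau> c) ` (D \<times> UNIV)"
  unfolding vertices_in_def by force

lemma edges_in_image: "edges_in X D = (\<lambda>(\<tau>, c). edge_of X \<tau> c) ` (D \<times> UNIV)"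
  unfolding edges_in_def by force

lemma vertices_in_Un: "vertices_in X (A \<union> D) = vertices_in X A \<union> vertices_in X D"
  by (simp add: vertices_in_image Sigma_Un_distrib1 image_Un)

lemma edges_in_Un: "edges_in X (A \<union> D) = edges_in X A \<union> edges_in X D"
  by (simp add: edges_in_image Sigma_Un_distrib1 image_Un)

lemma vertices_in_singleton: "vertices_in X {\<tau>} = range (corner X \<tau>)"
  unfolding vertices_in_def by blast

lemma edges_in_singleton: "edges_in X {\<tau>} = range (edge_of X \<tau>)"
  unfolding edges_in_def by blast

lemma corner_in_vertices_in: "\<tau> \<in> D \<Longrightarrow> corner X \<tau> c \<in> vertices_in X D"
  unfolding vertices_in_def by blast

lemma edge_of_in_edges_in: "\<tau> \<in> D \<Longrightarrow> edge_of X \<tau> c \<in> edges_in X D"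
  unfolding edges_in_def by blast

lemma finite_vertices_in: "finite D \<Longrightarrow> finite (vertices_in X D)"
  by (simp add: vertices_in_image)

lemma finite_edges_in: "finite D \<Longrightarrow> finite (edges_in X D)"
  by (simp add: edges_in_image)

section \<open>Alternation of black and white triangles\<close>

context trinity
begin

lemma finite_subset_triangles: "D \<subseteq> triangles X \<Longrightarrow> finite D"
  using finite_triangles by (rule finite_subset[rotated])

lemma black_triangle_cw:
  "\<tau> \<in> black_triangles X \<Longrightarrow> cw X \<tau> Blue = Green \<and> cw X \<tau> Green = Red \<and> cw X \<tau> Red = Blue"
  by (simp add: black_triangles_def)

text \<open>There are only two cyclic orders of three colours, so a triangle that is not black has
  the reverse order.\<close>

lemma white_triangle_cw:
  assumes "\<tau> \<in> white_triangles X"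
  shows "cw X \<tau> Green = Blue \<and> cw X \<tau> Red = Green \<and> cw X \<tau> Blue = Red"
proof -
  have \<tau>: "\<tau> \<in> triangles X" and nb: "\<tau> \<notin> black_triangles X"
    using assms by (auto simp: white_triangles_def)
  note cy = cw_cyclic[OF \<tau>]
  show ?thesis
    using cy[of Red] cy[of Green] cy[of Blue] nb \<tau> unfolding black_triangles_def
    by (cases "cw X \<tau> Red"; cases "cw X \<tau> Green"; cases "cw X \<tau> Blue") auto
qed

lemma black_or_white: "\<tau> \<in> triangles X \<Longrightarrow> \<tau> \<in> black_triangles X \<or> \<tau> \<in> white_triangles X"
  by (simp add: white_triangles_def)

lemma black_triangle_in: "\<tau> \<in> black_triangles X \<Longrightarrow> \<tau> \<in> triangles X"
  by (simp add: black_triangles_def)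

lemma white_triangle_in: "\<tau> \<in> white_triangles X \<Longrightarrow> \<tau> \<in> triangles X"
  by (simp add: white_triangles_def)

lemma white_not_black: "\<tau> \<in> white_triangles X \<Longrightarrow> \<tau> \<notin> black_triangles X"
  by (simp add: white_triangles_def)

text \<open>All triangles of one colour share one function \<open>cw\<close>; this yields the
  condition \<open>cw_p\<close> when a black triangle is replaced by a block whose boundary
  triangles are black.\<close>

lemma cw_eq_of_black: "\<tau> \<in> black_triangles X \<Longrightarrow> cw X \<tau> = (\<lambda>c. case c of Red \<Rightarrow> Blue | Green \<Rightarrow> Red | Blue \<Rightarrow> Green)"
  using black_triangle_cw[of \<tau>] by (auto simp: fun_eq_iff split: color.split)

lemma cw_eq_of_white: "\<tau> \<in> white_triangles X \<Longrightarrow> cw X \<tau> = (\<lambda>c. case c of Red \<Rightarrow> Green | Green \<Rightarrow> Blue | Blue \<Rightarrow> Red)"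
  using white_triangle_cw[of \<tau>] by (auto simp: fun_eq_iff split: color.split)

text \<open>Two triangles at an edge run through it in opposite directions and so carry opposite
  cyclic orders. The dual graph is therefore bipartite.\<close>

lemma across_of_black:
  assumes "\<tau> \<in> black_triangles X" shows "across X \<tau> c \<in> white_triangles X"
proof (rule ccontr)
  have \<tau>: "\<tau> \<in> triangles X" using assms by (rule black_triangle_in)
  assume "\<not> ?thesis"
  then have b: "across X \<tau> c \<in> black_triangles X"
    using black_or_white across_closed[OF \<tau>] by blast
  show False
    using cw_coherent[OF \<tau>, of Red c] cw_coherent[OF \<tau>, of Green c] cw_coherent[OF \<tau>, of Blue c]
      black_triangle_cw[OF b] black_triangle_cw[OF assms]
    by (cases c) simp_all
qed

lemma across_of_white:
  assumes "\<tau> \<in> white_triangles X" shows "across X \<tau> c \<in> black_triangles X"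
proof (rule ccontr)
  have \<tau>: "\<tau> \<in> triangles X" using assms by (rule white_triangle_in)
  assume "\<not> ?thesis"
  then have b: "across X \<tau> c \<in> white_triangles X"
    using black_or_white across_closed[OF \<tau>] by blast
  show False
    using cw_coherent[OF \<tau>, of Red c] cw_coherent[OF \<tau>, of Green c] cw_coherent[OF \<tau>, of Blue c]
      white_triangle_cw[OF b] white_triangle_cw[OF assms]
    by (cases c) simp_all
qed

lemma across_black_iff:
  "\<tau> \<in> triangles X \<Longrightarrow> across X \<tau> c \<in> black_triangles X \<longleftrightarrow> \<tau> \<notin> black_triangles X"
  using across_of_black across_of_white black_or_white white_not_black by blast

lemma across_neq: "\<tau> \<in> triangles X \<Longrightarrow> across X \<tau> c \<noteq> \<tau>"
  using across_black_iff by metis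

lemma across_eq_iff:
  "\<tau> \<in> triangles X \<Longrightarrow> \<sigma> \<in> triangles X \<Longrightarrow> across X \<tau> c = \<sigma> \<longleftrightarrow> \<tau> = across X \<sigma> c"
  using across_invol by metis

lemma corner_eq_iff:
  "\<tau> \<in> triangles X \<Longrightarrow> \<sigma> \<in> triangles X \<Longrightarrow> corner X \<tau> c = corner X \<sigma> d \<Longrightarrow> c = d"
  using vcolor_corner by metis

lemma edge_of_across: "\<tau> \<in> triangles X \<Longrightarrow> edge_of X (across X \<tau> c) c = edge_of X \<tau> c"
  by (auto simp: edge_of_def across_invol)

lemma edge_of_eq_iff:
  "\<tau> \<in> triangles X \<Longrightarrow> \<sigma> \<in> triangles X \<Longrightarrow>
    edge_of X \<tau> c = edge_of X \<sigma> d \<longleftrightarrow> c = d \<and> (\<sigma> = \<tau> \<or> \<sigma> = across X \<tau> c)"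
  by (auto simp: edge_of_def doubleton_eq_iff across_invol)

lemma inj_corner: "\<tau> \<in> triangles X \<Longrightarrow> inj (corner X \<tau>)"
  by (rule injI) (rule corner_eq_iff)

lemma card_corners: "\<tau> \<in> triangles X \<Longrightarrow> card (range (corner X \<tau>)) = 3"
  using card_image[OF inj_corner] by simp

text \<open>Follow the cycle of triangles around the corner of \<open>\<Delta>\<close> whose colour is neither \<open>c\<close> nor \<open>c'\<close>.\<close>

lemma neighbours_connected:
  assumes \<Delta>: "\<Delta> \<in> triangles X" and A: "across X \<Delta> c \<in> A"
    and closed: "\<And>\<alpha> d. \<alpha> \<in> A \<Longrightarrow> across X \<alpha> d \<noteq> \<Delta> \<Longrightarrow> across X \<alpha> d \<in> A"
    and sub: "A \<subseteq> triangles X"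
  shows "across X \<Delta> c' \<in> A"
proof -
  \<comment> \<open>Being the identity off \<open>triangles X\<close> makes \<open>f\<close>
    injective on the whole type, so that a finite orbit returns to its start.\<close>
  define f where "f \<tau> = (if \<tau> \<in> triangles X then across X (across X \<tau> c) c' else \<tau>)" for \<tau>
  have f_in: "f \<tau> \<in> triangles X \<longleftrightarrow> \<tau> \<in> triangles X" for \<tau>
    by (auto simp: f_def across_closed)
  have "inj f"
  proof (rule injI)
    fix x y assume *: "f x = f y"
    then have "x \<in> triangles X \<longleftrightarrow> y \<in> triangles X" using f_in by metis
    with * show "x = y"
      by (cases "x \<in> triangles X") (auto simp: f_def across_closed, metis across_closed across_invol)
  qed
  have orbit_in: "(f ^^ n) \<Delta> \<in> triangles X" for n
    by (induction n) (auto simp: f_in \<Delta>)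
  then have "finite {y. \<exists>n. y = (f ^^ n) \<Delta>}"
    using finite_triangles by (auto intro: finite_subset)
  then obtain m where m: "0 < m" "(f ^^ m) \<Delta> = \<Delta>"
    using funpow_inj_finite[OF \<open>inj f\<close>] by metis
  define n where "n = (LEAST m. 0 < m \<and> (f ^^ m) \<Delta> = \<Delta>)"
  have n: "0 < n" "(f ^^ n) \<Delta> = \<Delta>"
    using LeastI[of "\<lambda>m. 0 < m \<and> (f ^^ m) \<Delta> = \<Delta>" m] m unfolding n_def by auto
  have least: "(f ^^ k) \<Delta> \<noteq> \<Delta>" if "0 < k" "k < n" for k
    using not_less_Least[of k "\<lambda>m. 0 < m \<and> (f ^^ m) \<Delta> = \<Delta>"] that unfolding n_def by auto
  \<comment> \<open>Each \<open>f\<close> crosses two sides and keeps the colour. The triangle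
    halfway has the opposite colour and so is never \<open>\<Delta>\<close>; for the orbit itself,
    \<open>least\<close> excludes \<open>\<Delta>\<close> before the first return.\<close>
  have col: "(f ^^ k) \<Delta> \<in> black_triangles X \<longleftrightarrow> \<Delta> \<in> black_triangles X" for k
    by (induction k) (use orbit_in in \<open>auto simp: f_def across_black_iff across_closed\<close>)
  have in_A: "across X ((f ^^ k) \<Delta>) c \<in> A" if "k < n" for k
    using that
  proof (induction k)
    case 0 then show ?case using A by simp
  next
    case (Suc k)
    have "(f ^^ Suc k) \<Delta> = across X (across X ((f ^^ k) \<Delta>) c) c'"
      using orbit_in[of k] by (simp add: f_def)
    then have "(f ^^ Suc k) \<Delta> \<in> A"
      using closed Suc least[of "Suc k"] by (metis Suc_lessD zero_less_Suc)
    moreover have "across X ((f ^^ Suc k) \<Delta>) c \<noteq> \<Delta>"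
      using across_black_iff[OF orbit_in[of "Suc k"]] col[of "Suc k"] by metis
    ultimately show ?case using closed by blast
  qed
  obtain k where k: "n = Suc k" using n by (cases n) auto
  have "across X (across X ((f ^^ k) \<Delta>) c) c' = \<Delta>"
    using n orbit_in[of k] by (simp add: f_def k)
  then have "across X \<Delta> c' = across X ((f ^^ k) \<Delta>) c"
    using across_invol across_closed orbit_in by metis
  then show ?thesis using in_A[of k] k by simp
qed

text \<open>A closed part that did not touch \<open>\<Delta>\<close> would be all of
  \<open>X\<close>. So it contains one neighbour of \<open>\<Delta>\<close>, hence all of them by
  \<open>neighbours_connected\<close>, and it stays closed when \<open>\<Delta>\<close> is
  added.\<close>

lemma edge_connected_remove:
  assumes \<Delta>: "\<Delta> \<in> triangles X"
  shows "edge_connected X (triangles X - {\<Delta>})"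
  unfolding edge_connected_iff_cut
proof (intro allI impI; elim conjE)
  fix A assume A: "A \<subseteq> triangles X - {\<Delta>}" "A \<noteq> {}"
    and cl: "\<forall>\<alpha>\<in>A. \<forall>c. across X \<alpha> c \<in> triangles X - {\<Delta>} \<longrightarrow> across X \<alpha> c \<in> A"
  have closed: "across X \<alpha> d \<in> A" if "\<alpha> \<in> A" "across X \<alpha> d \<noteq> \<Delta>" for \<alpha> d
    using that cl A across_closed by blast
  have "\<exists>\<alpha>\<in>A. \<exists>c. across X \<alpha> c = \<Delta>"
  proof (rule ccontr)
    assume no: "\<not> ?thesis"
    have "A = triangles X"
      using edge_connectedD[OF connected, of A] A closed no by blast
    then show False using A \<Delta> by auto
  qed
  then obtain \<alpha> c where "\<alpha> \<in> A" "across X \<alpha> c = \<Delta>" by blast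
  then have "across X \<Delta> c \<in> A" using A across_invol by auto
  then have nb: "across X \<Delta> c' \<in> A" for c'
    using neighbours_connected[OF \<Delta> _ closed] A by blast
  have "insert \<Delta> A = triangles X"
    by (rule edge_connectedD[OF connected]) (use A \<Delta> nb closed in auto)
  then show "A = triangles X - {\<Delta>}" using A by auto
qed

end

section \<open>Euler characteristic\<close>

text \<open>The assumption \<open>cut\<close> says that the multigraph is connected.\<close>

lemma card_vertices_le_Suc_card_edges:
  assumes V: "finite V" and E: "finite E"
    and ends: "\<And>e. e \<in> E \<Longrightarrow> \<exists>x y. ends e = {x, y}"
    and cut: "\<And>U. U \<subset> V \<Longrightarrow> U \<noteq> {} \<Longrightarrow> \<exists>e\<in>E. ends e \<inter> U \<noteq> {} \<and> ends e \<inter> (V - U) \<noteq> {}"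
  shows "card V \<le> Suc (card E)"
proof (cases "V = {}")
  case False
  \<comment> \<open>A tree grows from a root by one edge and one new vertex at a time. The next edge
    leaves \<open>U\<close>, whereas those in \<open>G\<close> have their ends in \<open>U\<close>,
    so it is not yet in \<open>G\<close>.\<close>
  have grow: "\<exists>U G. U \<subseteq> V \<and> U \<noteq> {} \<and> G \<subseteq> E \<and> card U = Suc n \<and> card G = n \<and> (\<forall>e\<in>G. ends e \<subseteq> U)"
    if "n < card V" for n
    using that
  proof (induction n)
    case 0
    obtain r where "r \<in> V" using False by auto
    then show ?case by (intro exI[of _ "{r}"] exI[of _ "{}"]) auto
  next
    case (Suc n)
    then obtain U G where UG: "U \<subseteq> V" "U \<noteq> {}" "G \<subseteq> E" "card U = Suc n" "card G = n"
      "\<forall>e\<in>G. ends e \<subseteq> U" by auto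
    have "U \<subset> V" using UG Suc by auto
    then obtain e where e: "e \<in> E" "ends e \<inter> U \<noteq> {}" "ends e \<inter> (V - U) \<noteq> {}"
      using cut[OF _ UG(2)] by blast
    obtain x where x: "x \<in> ends e" "x \<in> U" using e(2) by blast
    obtain y where y: "y \<in> ends e" "y \<in> V - U" using e(3) by blast
    obtain x' y' where "ends e = {x', y'}" using ends[OF e(1)] by blast
    with x y have xy: "ends e = {x, y}" "x \<in> U" "y \<in> V - U" by auto
    have "finite U" "finite G" using UG V E finite_subset by blast+
    moreover have "e \<notin> G" using UG xy by auto
    ultimately show ?case
      using UG xy e by (intro exI[of _ "insert y U"] exI[of _ "insert e G"]) auto
  qed
  have "card V - 1 < card V" using False V by (simp add: card_gt_0_iff)
  from grow[OF this] obtain G where "G \<subseteq> E" "card G = card V - 1" by blast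
  then have "card V - 1 \<le> card E" using card_mono[OF E, of G] by simp
  then show ?thesis by linarith
qed simp

context trinity
begin

text \<open>An edge records only its colour and its two triangles. By \<open>corner_across\<close>
  both triangles contribute the same two end vertices.\<close>

definition edge_ends :: "color \<times> 't set \<Rightarrow> 'v set" where
  "edge_ends e = {corner X \<tau> d | \<tau> d. \<tau> \<in> snd e \<and> d \<noteq> fst e}"

lemma edge_ends_edge_of:
  "\<tau> \<in> triangles X \<Longrightarrow> edge_ends (edge_of X \<tau> c) = {corner X \<tau> d | d. d \<noteq> c}"
  unfolding edge_ends_def edge_of_def by (auto simp: corner_across)

text \<open>
  Tree-cotree decomposition: \<open>T\<close> is the set of edges crossed by a spanning tree of the dual graph
  of \<open>A\<close>. The edges not in \<open>T\<close> still connect all vertices, since gluing a further triangle along an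
  edge \<open>ab\<close> replaces the link \<open>ab\<close> by the path through the third vertex.
\<close>

lemma tree_cotree:
  assumes D: "D \<subseteq> triangles X" "edge_connected X D"
    and n: "n < card D"
  shows "\<exists>A T. A \<subseteq> D \<and> card A = Suc n \<and> T \<subseteq> edges_in X A \<and> card T = n \<and>
    (\<forall>e\<in>T. snd e \<subseteq> A) \<and>
    (\<forall>U. U \<subset> vertices_in X A \<longrightarrow> U \<noteq> {} \<longrightarrow>
      (\<exists>e\<in>edges_in X A - T. edge_ends e \<inter> U \<noteq> {} \<and> edge_ends e \<inter> (vertices_in X A - U) \<noteq> {}))"
  using n
proof (induction n)
  case 0
  then obtain \<tau> where \<tau>: "\<tau> \<in> D" by (metis card.empty ex_in_conv less_irrefl)
  then have \<tau>X: "\<tau> \<in> triangles X" using D by auto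
  have "\<exists>e\<in>edges_in X {\<tau>} - {}. edge_ends e \<inter> U \<noteq> {} \<and> edge_ends e \<inter> (vertices_in X {\<tau>} - U) \<noteq> {}"
    if U: "U \<subset> vertices_in X {\<tau>}" "U \<noteq> {}" for U
  proof -
    obtain d d' where dd: "corner X \<tau> d \<in> U" "corner X \<tau> d' \<notin> U"
      using U unfolding vertices_in_def by blast
    obtain c where c: "c \<noteq> d" "c \<noteq> d'"
      by (cases d; cases d') auto
    have "edge_of X \<tau> c \<in> edges_in X {\<tau>}" unfolding edges_in_def by blast
    moreover have "corner X \<tau> d \<in> edge_ends (edge_of X \<tau> c)" "corner X \<tau> d' \<in> edge_ends (edge_of X \<tau> c)"
      using c unfolding edge_ends_edge_of[OF \<tau>X] by auto
    moreover have "corner X \<tau> d' \<in> vertices_in X {\<tau>}" unfolding vertices_in_def by blast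
    ultimately show ?thesis using dd by blast
  qed
  then show ?case
    using \<tau> by (intro exI[of _ "{\<tau>}"] exI[of _ "{}"]) auto
next
  case (Suc n)
  then obtain A T where AT: "A \<subseteq> D" "card A = Suc n" "T \<subseteq> edges_in X A" "card T = n"
    and int: "\<forall>e\<in>T. snd e \<subseteq> A"
    and cut: "\<And>U. U \<subset> vertices_in X A \<Longrightarrow> U \<noteq> {} \<Longrightarrow>
      (\<exists>e\<in>edges_in X A - T. edge_ends e \<inter> U \<noteq> {} \<and> edge_ends e \<inter> (vertices_in X A - U) \<noteq> {})"
    by auto
  have "A \<noteq> D" "A \<noteq> {}" using AT Suc by auto
  then obtain \<alpha> c where \<alpha>: "\<alpha> \<in> A" "across X \<alpha> c \<in> D - A"
    using edge_connectedD[OF D(2) AT(1)] by blast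
  define \<tau> where "\<tau> = across X \<alpha> c"
  have X: "\<alpha> \<in> triangles X" "\<tau> \<in> triangles X" and \<tau>: "\<tau> \<in> D" "\<tau> \<notin> A"
    using \<alpha> AT D by (auto simp: \<tau>_def)
  define e where "e = edge_of X \<tau> c"
  have e_\<alpha>: "e = edge_of X \<alpha> c" by (simp add: e_def \<tau>_def edge_of_across[OF X(1)])
  obtain d d' where d: "d \<noteq> c" "d' \<noteq> c" "d \<noteq> d'" "UNIV = {c, d, d'}" by (rule other_colors)
  have cols: "x = c \<or> x = d \<or> x = d'" for x using d(4) by auto
  let ?A = "insert \<tau> A" and ?T = "insert e T"
  let ?a = "corner X \<tau> d" and ?b = "corner X \<tau> d'" and ?v = "corner X \<tau> c"
  \<comment> \<open>By \<open>int\<close> both triangles of an edge in \<open>T\<close> lie in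
    \<open>A\<close>, and the new triangle does not.\<close>
  have \<tau>_edge: "edge_of X \<tau> x \<notin> T" for x using int \<tau> by (force simp: edge_of_def)
  have verts: "vertices_in X ?A = insert ?v (vertices_in X A)"
  proof -
    have "?a = corner X \<alpha> d" "?b = corner X \<alpha> d'"
      using corner_across[OF X(1)] d by (auto simp: \<tau>_def)
    then have "corner X \<tau> x \<in> insert ?v (vertices_in X A)" for x
      using cols[of x] \<alpha> unfolding vertices_in_def by auto
    then show ?thesis unfolding vertices_in_def by blast
  qed
  have ab: "?a \<in> vertices_in X A" "?b \<in> vertices_in X A"
    using corner_across[OF X(1)] d \<alpha>(1) unfolding \<tau>_def vertices_in_def by auto
  have ends_e: "edge_ends e = {?a, ?b}"
    unfolding e_def edge_ends_edge_of[OF X(2)] using d cols by blast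
  have "{corner X \<tau> x | x. x \<noteq> d} = corner X \<tau> ` {c, d'}" "{corner X \<tau> x | x. x \<noteq> d'} = corner X \<tau> ` {c, d}"
    using d(1-3) cols by (auto, metis+)
  then have ends_d: "edge_ends (edge_of X \<tau> d) = {?v, ?b}" "edge_ends (edge_of X \<tau> d') = {?v, ?a}"
    unfolding edge_ends_edge_of[OF X(2)] by simp_all
  have edges: "edge_of X \<tau> d \<in> edges_in X ?A - ?T" "edge_of X \<tau> d' \<in> edges_in X ?A - ?T"
    using \<tau>_edge d unfolding e_def edges_in_def by (auto simp: edge_of_def)
  have "edges_in X A \<subseteq> edges_in X ?A" unfolding edges_in_def by auto
  have cut': "\<exists>f\<in>edges_in X ?A - ?T. edge_ends f \<inter> U \<noteq> {} \<and> edge_ends f \<inter> (vertices_in X ?A - U) \<noteq> {}"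
    if U: "U \<subset> vertices_in X ?A" "U \<noteq> {}" for U
  proof -
    consider (split) "\<not> vertices_in X A \<subseteq> U" "U \<inter> vertices_in X A \<noteq> {}"
      | (above) "vertices_in X A \<subseteq> U" | (below) "U \<inter> vertices_in X A = {}" by blast
    then show ?thesis
    proof cases
      case split
      then obtain f where f: "f \<in> edges_in X A - T" "edge_ends f \<inter> (U \<inter> vertices_in X A) \<noteq> {}"
        "edge_ends f \<inter> (vertices_in X A - U \<inter> vertices_in X A) \<noteq> {}"
        using cut[of "U \<inter> vertices_in X A"] by blast
      show ?thesis
      proof (cases "f = e")
        case False
        then have "f \<in> edges_in X ?A - ?T" using f \<open>edges_in X A \<subseteq> edges_in X ?A\<close> by auto
        then show ?thesis using f verts by blast
      next
        case True
        then have "(?a \<in> U \<and> ?b \<notin> U) \<or> (?a \<notin> U \<and> ?b \<in> U)" using f ends_e by auto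
        then have "edge_ends (edge_of X \<tau> d) \<inter> U \<noteq> {} \<and> edge_ends (edge_of X \<tau> d) \<inter> (vertices_in X ?A - U) \<noteq> {} \<or>
          edge_ends (edge_of X \<tau> d') \<inter> U \<noteq> {} \<and> edge_ends (edge_of X \<tau> d') \<inter> (vertices_in X ?A - U) \<noteq> {}"
          unfolding ends_d verts using ab by blast
        then show ?thesis using edges by blast
      qed
    next
      case above
      then have "?v \<notin> U" "?a \<in> U" using U verts ab by auto
      then show ?thesis using edges(2) ends_d(2) verts by (intro bexI[OF _ edges(2)]) auto
    next
      case below
      then have "?v \<in> U" "?a \<notin> U" using U verts ab by auto
      then show ?thesis using edges(2) ends_d(2) verts ab by (intro bexI[OF _ edges(2)]) auto
    qed
  qed
  have "finite A" using AT(2) card.infinite by fastforce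
  have "finite T" using finite_subset[OF AT(3) finite_edges_in[OF \<open>finite A\<close>]] .
  have "?A \<subseteq> D" "card ?A = Suc (Suc n)" "card ?T = Suc n"
    using AT \<tau> \<open>finite A\<close> \<open>finite T\<close> \<tau>_edge[of c] by (auto simp: e_def)
  moreover have "?T \<subseteq> edges_in X ?A"
    using AT(3) \<open>edges_in X A \<subseteq> edges_in X ?A\<close> unfolding e_def edges_in_def by blast
  moreover have "\<forall>f\<in>?T. snd f \<subseteq> ?A"
    using int \<alpha>(1) by (auto simp: e_\<alpha> edge_of_def \<tau>_def)
  ultimately show ?case using cut' by (intro exI[of _ ?A] exI[of _ ?T]) blast
qed

text \<open>With V vertices, E edges and F triangles, the cotree accounts for F - 1 edges and the
  remaining ones still connect all vertices, so there are at least V - 1 of them. Hence E \<ge> V +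
  F - 2.\<close>

lemma euler_char_le_2:
  assumes D: "D \<subseteq> triangles X" "edge_connected X D" "D \<noteq> {}"
  shows "euler_char X D \<le> 2"
proof -
  have fin: "finite D" using D(1) by (rule finite_subset_triangles)
  have pos: "card D > 0" using D fin by auto
  obtain A T where AT: "A \<subseteq> D" "card A = Suc (card D - 1)" "T \<subseteq> edges_in X A" "card T = card D - 1"
    and cut: "\<And>U. U \<subset> vertices_in X A \<Longrightarrow> U \<noteq> {} \<Longrightarrow>
      (\<exists>e\<in>edges_in X A - T. edge_ends e \<inter> U \<noteq> {} \<and> edge_ends e \<inter> (vertices_in X A - U) \<noteq> {})"
    using tree_cotree[OF D(1,2), of "card D - 1"] pos by auto
  have A: "A = D" using AT pos fin by (intro card_subset_eq) auto
  have "\<exists>x y. edge_ends e = {x, y}" if e: "e \<in> edges_in X A - T" for e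
  proof -
    obtain \<tau> c where \<tau>: "e = edge_of X \<tau> c" "\<tau> \<in> triangles X"
      using e A D unfolding edges_in_def by blast
    obtain d d' where "d \<noteq> c" "d' \<noteq> c" "d \<noteq> d'" "UNIV = {c, d, d'}" by (rule other_colors)
    then have "edge_ends e = {corner X \<tau> d, corner X \<tau> d'}"
      unfolding \<tau> edge_ends_edge_of[OF \<tau>(2)] by blast
    then show ?thesis by blast
  qed
  then have "card (vertices_in X D) \<le> Suc (card (edges_in X D - T))"
    using card_vertices_le_Suc_card_edges[of "vertices_in X A" "edges_in X A - T" edge_ends]
      cut finite_vertices_in[OF fin, of X] finite_edges_in[OF fin, of X] unfolding A by auto
  moreover have "card (edges_in X D - T) = card (edges_in X D) - card T"
    using AT(3) finite_edges_in[OF fin] unfolding A by (metis card_Diff_subset finite_subset)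
  moreover have "card T \<le> card (edges_in X D)"
    using AT(3) finite_edges_in[OF fin] unfolding A by (rule card_mono[rotated])
  ultimately show ?thesis
    unfolding euler_char_def using AT(4) pos by linarith
qed

text \<open>
  If all triangles of \<open>D\<close> at its boundary are black, then every edge of \<open>D\<close> is the side of exactly one
  black triangle of \<open>D\<close>, and the black sides are the boundary sides and those across white sides.
\<close>

lemma vertex_count:
  assumes D: "D \<subseteq> triangles X" and bd: "\<And>\<tau> c. (\<tau>, c) \<in> boundary_sides X D \<Longrightarrow> \<tau> \<in> black_triangles X"
  shows "3 * int (card (vertices_in X D)) =
    3 * euler_char X D + 3 * int (card (D \<inter> white_triangles X)) + 2 * int (card (boundary_sides X D))"
proof -
  let ?b = "D \<inter> black_triangles X" and ?w = "D \<inter> white_triangles X"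
  have fin: "finite D" using D by (rule finite_subset_triangles)
  have "inj_on (\<lambda>(\<tau>, c). edge_of X \<tau> c) (?b \<times> UNIV)"
  proof (rule inj_onI, clarify)
    fix \<tau> c \<sigma> d assume "\<tau> \<in> black_triangles X" "\<sigma> \<in> black_triangles X" "edge_of X \<tau> c = edge_of X \<sigma> d"
    then show "\<tau> = \<sigma> \<and> c = d"
      using edge_of_eq_iff[of \<tau> \<sigma> c d] black_triangle_in across_of_black white_not_black by blast
  qed
  moreover have "edges_in X D = (\<lambda>(\<tau>, c). edge_of X \<tau> c) ` (?b \<times> UNIV)"
  proof
    show "edges_in X D \<subseteq> (\<lambda>(\<tau>, c). edge_of X \<tau> c) ` (?b \<times> UNIV)"
    proof
      fix e assume "e \<in> edges_in X D"
      then obtain \<tau> c where \<tau>: "e = edge_of X \<tau> c" "\<tau> \<in> D" unfolding edges_in_def by blast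
      have \<tau>X: "\<tau> \<in> triangles X" using \<tau> D by auto
      show "e \<in> (\<lambda>(\<tau>, c). edge_of X \<tau> c) ` (?b \<times> UNIV)"
      proof (cases "\<tau> \<in> black_triangles X")
        case True then show ?thesis using \<tau> by force
      next
        \<comment> \<open>A side of a white triangle is not a boundary side, so the black triangle
          beyond it lies in \<open>D\<close> and has the same edge.\<close>
        case False
        then have "across X \<tau> c \<in> ?b"
          using bd[of \<tau> c] \<tau> across_black_iff[OF \<tau>X] by (auto simp: boundary_sides_def)
        then show ?thesis
          unfolding \<tau>(1) edge_of_across[OF \<tau>X, of c, symmetric] by force
      qed
    qed
  qed (auto simp: edges_in_def)
  ultimately have E: "card (edges_in X D) = 3 * card ?b"
    by (simp add: card_image card_cartesian_product)
  have "?b \<times> UNIV = boundary_sides X D \<union> (\<lambda>(\<tau>, c). (across X \<tau> c, c)) ` (?w \<times> UNIV)"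
  proof
    show "?b \<times> UNIV \<subseteq> boundary_sides X D \<union> (\<lambda>(\<tau>, c). (across X \<tau> c, c)) ` (?w \<times> UNIV)"
    proof (intro subsetI UnCI)
      fix x assume "x \<in> ?b \<times> UNIV" and "x \<notin> (\<lambda>(\<tau>, c). (across X \<tau> c, c)) ` (?w \<times> UNIV)"
      then obtain \<tau> c where x: "x = (\<tau>, c)" and \<tau>: "\<tau> \<in> D" "\<tau> \<in> black_triangles X"
        and no: "(\<tau>, c) \<notin> (\<lambda>(\<tau>, c). (across X \<tau> c, c)) ` (?w \<times> UNIV)"
        by blast
      have "across X \<tau> c \<notin> D"
      proof
        assume "across X \<tau> c \<in> D"
        then have "(across X \<tau> c, c) \<in> ?w \<times> UNIV" using across_of_black \<tau> by auto
        then have "(across X (across X \<tau> c) c, c) \<in> (\<lambda>(\<tau>, c). (across X \<tau> c, c)) ` (?w \<times> UNIV)"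
          by force
        moreover have "across X (across X \<tau> c) c = \<tau>" using across_invol D \<tau> by blast
        ultimately show False using no by simp
      qed
      then show "x \<in> boundary_sides X D" using x \<tau> by (auto simp: boundary_sides_def)
    qed
    show "boundary_sides X D \<union> (\<lambda>(\<tau>, c). (across X \<tau> c, c)) ` (?w \<times> UNIV) \<subseteq> ?b \<times> UNIV"
    proof (rule subrelI)
      fix \<tau> c assume "(\<tau>, c) \<in> boundary_sides X D \<union> (\<lambda>(\<tau>, c). (across X \<tau> c, c)) ` (?w \<times> UNIV)"
      then show "(\<tau>, c) \<in> ?b \<times> UNIV"
      proof
        assume "(\<tau>, c) \<in> boundary_sides X D"
        then show ?thesis using bd by (auto simp: boundary_sides_def)
      next
        assume "(\<tau>, c) \<in> (\<lambda>(\<tau>, c). (across X \<tau> c, c)) ` (?w \<times> UNIV)"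
        then obtain \<sigma> where \<sigma>: "\<sigma> \<in> D" "\<sigma> \<in> white_triangles X" "\<tau> = across X \<sigma> c" by auto
        then have "\<tau> \<in> D" using bd[of \<sigma> c] white_not_black by (auto simp: boundary_sides_def)
        then show ?thesis using \<sigma> across_of_white by auto
      qed
    qed
  qed
  moreover have "boundary_sides X D \<inter> (\<lambda>(\<tau>, c). (across X \<tau> c, c)) ` (?w \<times> UNIV) = {}"
    using D by (auto simp: boundary_sides_def across_invol subset_iff)
  moreover have "inj_on (\<lambda>(\<tau>, c). (across X \<tau> c, c)) (?w \<times> UNIV)"
    using white_triangle_in by (intro inj_onI) (auto, metis across_invol)
  moreover have "finite (?b \<times> (UNIV :: color set))" using fin by auto
  ultimately have "card (?b \<times> (UNIV :: color set)) = card (boundary_sides X D) + card (?w \<times> (UNIV :: color set))"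
    by (simp only: card_Un_disjoint card_image finite_Un)
  then have b: "3 * card ?b = card (boundary_sides X D) + 3 * card ?w"
    by (simp add: card_cartesian_product)
  have "D = ?b \<union> ?w" "?b \<inter> ?w = {}" using D black_or_white white_not_black by blast+
  then have "card D = card ?b + card ?w" using fin by (metis card_Un_disjoint finite_Un)
  then have "int (card D) = int (card ?b) + int (card ?w)" by simp
  moreover have "3 * int (card ?b) = int (card (boundary_sides X D)) + 3 * int (card ?w)"
    using b by linarith
  moreover have "int (card (edges_in X D)) = 3 * int (card ?b)" using E by simp
  \<comment> \<open>With b black and w white triangles and k boundary sides, E = 3b, F = b + w and
    3b = k + 3w give 3E - 3F = 6b - 3w = 3w + 2k.\<close>
  ultimately show ?thesis unfolding euler_char_def by (simp add: algebra_simps)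
qed

lemma boundary_sides_triangles [simp]: "boundary_sides X (triangles X) = {}"
  by (auto simp: boundary_sides_def across_closed)

lemma card_vertices:
  "int (card (vertices X)) = euler_char X (triangles X) + int (card (white_triangles X))"
proof -
  have "triangles X \<inter> white_triangles X = white_triangles X" by (auto simp: white_triangles_def)
  then show ?thesis using vertex_count[of "triangles X"] by (simp add: vertices_eq)
qed

text \<open>The neighbours of \<open>\<Delta>\<close> already contain all its vertices and edges, so
  only the number of triangles drops.\<close>

lemma euler_char_remove:
  assumes \<Delta>: "\<Delta> \<in> triangles X"
  shows "euler_char X (triangles X - {\<Delta>}) = euler_char X (triangles X) - 1"
proof -
  have nb: "across X \<Delta> c \<in> triangles X - {\<Delta>}" for c
    using across_closed[OF \<Delta>] across_neq[OF \<Delta>] by auto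
  have "corner X \<Delta> d \<in> vertices_in X (triangles X - {\<Delta>})" for d
  proof -
    obtain c where "d \<noteq> c" using other_colors by metis
    then have "corner X \<Delta> d = corner X (across X \<Delta> c) d" by (simp add: corner_across[OF \<Delta>])
    then show ?thesis using nb[of c] unfolding vertices_in_def by blast
  qed
  then have V: "vertices_in X (triangles X - {\<Delta>}) = vertices_in X (triangles X)"
    unfolding vertices_in_def by blast
  have "edge_of X \<Delta> c \<in> edges_in X (triangles X - {\<Delta>})" for c
    unfolding edge_of_across[OF \<Delta>, of c, symmetric] edges_in_def using nb[of c] by blast
  then have E: "edges_in X (triangles X - {\<Delta>}) = edges_in X (triangles X)"
    unfolding edges_in_def by blast
  have "int (card (triangles X)) = 1 + int (card (triangles X - {\<Delta>}))"
    using card.remove[OF finite_triangles \<Delta>] by linarith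
  then show ?thesis unfolding euler_char_def V E by linarith
qed

end

section \<open>Collapsing a block of triangles\<close>

lemma clock_diskE:
  assumes "clock_disk X D u W"
  obtains \<sigma> c where "D \<subseteq> triangles X" "edge_connected X D" "euler_char X D = 1" "inj_on u {..<3}"
    "boundary_sides X D = (\<lambda>i. (\<sigma> i, c i)) ` {..<3}"
    "\<forall>i<3. corner X (\<sigma> i) (cw X (\<sigma> i) (c i)) = u i \<and>
      corner X (\<sigma> i) (cw X (\<sigma> i) (cw X (\<sigma> i) (c i))) = u (Suc i mod 3) \<and>
      across X (\<sigma> i) (c i) = W i"
    "\<forall>i<3. W i \<in> white_triangles X"
  using assms unfolding clock_disk_def by (elim conjE exE) (rule that)

text \<open>
  \<open>X\<close> arises from \<open>Z\<close> by collapsing the block \<open>B\<close> of triangles to the single triangle \<open>\<Delta>\<close>; \<open>e\<close> and \<open>v\<close>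
  embed the other triangles and the vertices of \<open>X\<close>, and \<open>p c\<close> is the triangle of \<open>B\<close> at the side that
  becomes the side of \<open>\<Delta>\<close> opposite \<open>c\<close>. Both summands of a connected sum arise from it in this way.
\<close>

locale collapse = trinity X for X :: "('t, 'v) trinity_data" +
  fixes Z :: "('z, 'y) trinity_data" and \<Delta> :: 't and e :: "'t \<Rightarrow> 'z" and v :: "'v \<Rightarrow> 'y"
    and B :: "'z set" and p :: "color \<Rightarrow> 'z"
  assumes \<Delta>: "\<Delta> \<in> triangles X"
    and triangles_Z: "triangles Z = e ` (triangles X - {\<Delta>}) \<union> B"
    and inj_e: "inj_on e (triangles X - {\<Delta>})"
    and e_notin: "\<tau> \<in> triangles X \<Longrightarrow> \<tau> \<noteq> \<Delta> \<Longrightarrow> e \<tau> \<notin> B"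
    and finite_B: "finite B"
    and inj_v: "inj_on v (vertices X)"
    and p_in: "p c \<in> B"
    and corner_e: "\<tau> \<in> triangles X \<Longrightarrow> \<tau> \<noteq> \<Delta> \<Longrightarrow> corner Z (e \<tau>) c = v (corner X \<tau> c)"
    and corner_p: "d \<noteq> c \<Longrightarrow> corner Z (p c) d = v (corner X \<Delta> d)"
    and across_e: "\<tau> \<in> triangles X \<Longrightarrow> \<tau> \<noteq> \<Delta> \<Longrightarrow>
      across Z (e \<tau>) c = (if across X \<tau> c = \<Delta> then p c else e (across X \<tau> c))"
    and across_p: "across Z (p c) c = e (across X \<Delta> c)"
    and across_B: "\<beta> \<in> B \<Longrightarrow> across Z \<beta> c \<in> B \<or> \<beta> = p c"
    and cw_e: "\<tau> \<in> triangles X \<Longrightarrow> \<tau> \<noteq> \<Delta> \<Longrightarrow> cw Z (e \<tau>) = cw X \<tau>"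
    and cw_p: "cw Z (p c) = cw X \<Delta>"
    and connected_B: "edge_connected Z B"
    and vertices_B: "x \<in> vertices X \<Longrightarrow> v x \<in> vertices_in Z B \<Longrightarrow> x \<in> range (corner X \<Delta>)"
begin

text \<open>No single triangle of the block stands for \<open>\<Delta>\<close>. The index
  \<open>c\<close> names the side under consideration: \<open>emb c\<close> is faithful for crossing
  that side and for its two end vertices, not for the opposite corner.\<close>

definition emb :: "color \<Rightarrow> 't \<Rightarrow> 'z" where
  "emb c \<tau> = (if \<tau> = \<Delta> then p c else e \<tau>)"

text \<open>The preimage of \<open>D\<close> under the collapsing map.\<close>

definition lift :: "'t set \<Rightarrow> 'z set" where
  "lift D = e ` (D - {\<Delta>}) \<union> (if \<Delta> \<in> D then B else {})"

lemma across_emb: "\<tau> \<in> triangles X \<Longrightarrow> across Z (emb c \<tau>) c = emb c (across X \<tau> c)"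
  using across_neq[OF \<Delta>] by (simp add: emb_def across_e across_p)

lemma corner_emb: "\<tau> \<in> triangles X \<Longrightarrow> d \<noteq> c \<Longrightarrow> corner Z (emb c \<tau>) d = v (corner X \<tau> d)"
  by (simp add: emb_def corner_e corner_p)

lemma cw_emb: "\<tau> \<in> triangles X \<Longrightarrow> cw Z (emb c \<tau>) = cw X \<tau>"
  by (simp add: emb_def cw_e cw_p)

lemma inj_emb: "inj_on (emb c) (triangles X)"
proof (rule inj_onI)
  fix \<tau> \<sigma> assume *: "\<tau> \<in> triangles X" "\<sigma> \<in> triangles X" "emb c \<tau> = emb c \<sigma>"
  show "\<tau> = \<sigma>"
  proof (cases "\<tau> = \<Delta> \<or> \<sigma> = \<Delta>")
    case True
    then show ?thesis using * e_notin p_in unfolding emb_def by metis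
  next
    case False
    then show ?thesis using * inj_onD[OF inj_e, of \<tau> \<sigma>] by (simp add: emb_def)
  qed
qed

lemma emb_in_B_iff: "\<tau> \<in> triangles X \<Longrightarrow> emb c \<tau> \<in> B \<longleftrightarrow> \<tau> = \<Delta>"
  using e_notin p_in by (auto simp: emb_def)

lemma emb_in_lift_iff:
  assumes "D \<subseteq> triangles X" "\<tau> \<in> triangles X"
  shows "emb c \<tau> \<in> lift D \<longleftrightarrow> \<tau> \<in> D"
proof (cases "\<tau> = \<Delta>")
  case True
  have "p c \<noteq> e \<sigma>" if "\<sigma> \<in> D - {\<Delta>}" for \<sigma>
    using e_notin[of \<sigma>] p_in[of c] assms(1) that by auto
  then show ?thesis using p_in[of c] True by (auto simp: emb_def lift_def)
next
  case False
  moreover have "e \<tau> \<in> e ` (D - {\<Delta>}) \<longleftrightarrow> \<tau> \<in> D - {\<Delta>}"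
    by (rule inj_on_image_mem_iff[OF inj_e]) (use False assms in auto)
  ultimately show ?thesis using e_notin[OF assms(2)] by (simp add: emb_def lift_def)
qed

text \<open>Seen through its side of colour \<open>c\<close>, a triangle of the lift either comes
  from \<open>X\<close> together with that side, or the side is interior to the block.\<close>

lemma lift_cases:
  assumes "\<zeta> \<in> lift D"
  obtains (emb) \<tau> where "\<tau> \<in> D" "\<zeta> = emb c \<tau>" | (block) "\<Delta> \<in> D" "\<zeta> \<in> B" "across Z \<zeta> c \<in> B"
proof (cases "\<zeta> \<in> e ` (D - {\<Delta>})")
  case True
  then obtain \<tau> where "\<tau> \<in> D" "\<tau> \<noteq> \<Delta>" "\<zeta> = e \<tau>" by blast
  then show ?thesis using emb[of \<tau>] by (simp add: emb_def)
next
  case False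
  then have "\<Delta> \<in> D" "\<zeta> \<in> B" using assms by (auto simp: lift_def split: if_splits)
  then show ?thesis using across_B[of \<zeta> c] emb[of \<Delta>] block by (auto simp: emb_def)
qed

lemma lift_subset: "D \<subseteq> triangles X \<Longrightarrow> lift D \<subseteq> triangles Z"
  by (auto simp: lift_def triangles_Z)

lemma B_subset_lift: "\<Delta> \<in> D \<Longrightarrow> B \<subseteq> lift D"
  by (auto simp: lift_def)

lemma lift_Int_B: "D \<subseteq> triangles X \<Longrightarrow> \<zeta> \<in> lift D \<Longrightarrow> \<zeta> \<in> B \<Longrightarrow> \<Delta> \<in> D"
  using e_notin by (auto simp: lift_def split: if_splits)

lemma ex_lift:
  assumes E: "E \<subseteq> triangles Z" and B: "E \<inter> B \<noteq> {} \<Longrightarrow> B \<subseteq> E"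
  obtains D where "D \<subseteq> triangles X" "E = lift D"
proof -
  let ?D = "{\<tau> \<in> triangles X. if \<tau> = \<Delta> then B \<subseteq> E else e \<tau> \<in> E}"
  have "E = lift ?D"
    using E B \<Delta> e_notin p_in unfolding lift_def triangles_Z by (auto split: if_splits)
  then show thesis using that[of ?D] by blast
qed

lemma boundary_sides_lift:
  assumes D: "D \<subseteq> triangles X"
  shows "boundary_sides Z (lift D) = (\<lambda>(\<tau>, c). (emb c \<tau>, c)) ` boundary_sides X D"
proof (intro equalityI subrelI)
  fix \<zeta> c assume *: "(\<zeta>, c) \<in> boundary_sides Z (lift D)"
  then have \<zeta>: "\<zeta> \<in> lift D" "across Z \<zeta> c \<notin> lift D" by (auto simp: boundary_sides_def)
  from \<zeta>(1) show "(\<zeta>, c) \<in> (\<lambda>(\<tau>, c). (emb c \<tau>, c)) ` boundary_sides X D"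
  proof (cases rule: lift_cases[where c = c])
    case (emb \<tau>)
    then have "across X \<tau> c \<notin> D"
      using \<zeta>(2) across_emb[of \<tau> c] emb_in_lift_iff[OF D, of "across X \<tau> c" c] D across_closed[of \<tau> c] by auto
    then have "(\<tau>, c) \<in> boundary_sides X D" using emb by (simp add: boundary_sides_def)
    then show ?thesis using emb by force
  next
    case block then show ?thesis using \<zeta> B_subset_lift by auto
  qed
next
  fix \<zeta> c assume "(\<zeta>, c) \<in> (\<lambda>(\<tau>, c). (emb c \<tau>, c)) ` boundary_sides X D"
  then obtain \<tau> where \<tau>: "\<zeta> = emb c \<tau>" "\<tau> \<in> D" "across X \<tau> c \<notin> D"
    by (auto simp: boundary_sides_def)
  then show "(\<zeta>, c) \<in> boundary_sides Z (lift D)"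
    using D across_emb[of \<tau> c] across_closed[of \<tau> c] emb_in_lift_iff[OF D]
    by (auto simp: boundary_sides_def)
qed

text \<open>Downwards, the lift of a closed set is closed. Upwards, a closed set that meets the
  block contains it, since the block is connected, and is therefore itself a lift.\<close>

lemma edge_connected_lift_iff:
  assumes D: "D \<subseteq> triangles X"
  shows "edge_connected Z (lift D) \<longleftrightarrow> edge_connected X D"
proof
  assume conn: "edge_connected Z (lift D)"
  show "edge_connected X D"
    unfolding edge_connected_iff_cut
  proof (intro allI impI; elim conjE)
    fix A assume A: "A \<subseteq> D" "A \<noteq> {}" and cl: "\<forall>\<alpha>\<in>A. \<forall>c. across X \<alpha> c \<in> D \<longrightarrow> across X \<alpha> c \<in> A"
    have AX: "A \<subseteq> triangles X" using A D by auto
    have "lift A = lift D"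
    proof (rule edge_connectedD[OF conn])
      show "lift A \<subseteq> lift D" using A by (auto simp: lift_def)
      show "lift A \<noteq> {}" using A emb_in_lift_iff[OF AX] AX by blast
      fix \<zeta> c assume \<zeta>: "\<zeta> \<in> lift A" and ac: "across Z \<zeta> c \<in> lift D"
      from \<zeta> show "across Z \<zeta> c \<in> lift A"
      proof (cases rule: lift_cases[where c = c])
        case (emb \<tau>)
        then have \<tau>: "\<tau> \<in> triangles X" "across X \<tau> c \<in> triangles X" using AX across_closed by auto
        have "across X \<tau> c \<in> D"
          using ac across_emb[OF \<tau>(1)] emb emb_in_lift_iff[OF D \<tau>(2)] by auto
        then have "across X \<tau> c \<in> A" using cl emb by auto
        then show ?thesis
          using across_emb[OF \<tau>(1)] emb emb_in_lift_iff[OF AX \<tau>(2)] by auto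
      next
        case block then show ?thesis using B_subset_lift by auto
      qed
    qed
    then show "A = D" using emb_in_lift_iff[OF AX] emb_in_lift_iff[OF D] AX D by blast
  qed
next
  assume conn: "edge_connected X D"
  show "edge_connected Z (lift D)"
    unfolding edge_connected_iff_cut
  proof (intro allI impI; elim conjE)
    fix A assume A: "A \<subseteq> lift D" "A \<noteq> {}"
      and cl: "\<forall>\<alpha>\<in>A. \<forall>c. across Z \<alpha> c \<in> lift D \<longrightarrow> across Z \<alpha> c \<in> A"
    have B: "B \<subseteq> A" if "A \<inter> B \<noteq> {}"
    proof -
      have "B \<subseteq> lift D" using that A lift_Int_B[OF D] B_subset_lift by blast
      then have "A \<inter> B = B"
        by (intro edge_connectedD[OF connected_B]) (use that cl in auto)
      then show ?thesis by auto
    qed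
    obtain A' where A': "A' \<subseteq> triangles X" "A = lift A'"
      by (rule ex_lift[of A]) (use A B lift_subset[OF D] in auto)
    have "A' = D"
    proof (rule edge_connectedD[OF conn])
      show "A' \<subseteq> D"
        using A emb_in_lift_iff[OF A'(1)] emb_in_lift_iff[OF D] A' by blast
      show "A' \<noteq> {}" using A A' by (auto simp: lift_def)
      fix \<tau> c assume \<tau>: "\<tau> \<in> A'" "across X \<tau> c \<in> D"
      then have X: "\<tau> \<in> triangles X" "across X \<tau> c \<in> triangles X" using A' D by auto
      have "emb c \<tau> \<in> A" using emb_in_lift_iff[OF A'(1) X(1)] A' \<tau> by simp
      moreover have "across Z (emb c \<tau>) c = emb c (across X \<tau> c)" by (rule across_emb[OF X(1)])
      moreover have "emb c (across X \<tau> c) \<in> lift D" using emb_in_lift_iff[OF D X(2)] \<tau> by simp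
      ultimately have "emb c (across X \<tau> c) \<in> A" using cl by metis
      then show "across X \<tau> c \<in> A'" using emb_in_lift_iff[OF A'(1) X(2)] A' by simp
    qed
    then show "A = lift D" using A' by simp
  qed
qed

text \<open>The colour of the edge decides which triangle of the block replaces
  \<open>\<Delta>\<close>.\<close>

definition edge_emb :: "color \<times> 't set \<Rightarrow> color \<times> 'z set" where
  "edge_emb = (\<lambda>(c, P). (c, emb c ` P))"

lemma edge_emb_edge_of: "\<tau> \<in> triangles X \<Longrightarrow> edge_emb (edge_of X \<tau> c) = edge_of Z (emb c \<tau>) c"
  by (simp add: edge_emb_def edge_of_def across_emb)

lemma inj_edge_emb: "D \<subseteq> triangles X \<Longrightarrow> inj_on edge_emb (edges_in X D)"
proof (rule inj_onI)
  fix x y assume D: "D \<subseteq> triangles X" and xy: "x \<in> edges_in X D" "y \<in> edges_in X D" "edge_emb x = edge_emb y"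
  have sub: "snd z \<subseteq> triangles X" if z: "z \<in> edges_in X D" for z
  proof -
    obtain \<tau> c where "\<tau> \<in> D" "z = edge_of X \<tau> c" using z[unfolded edges_in_def] by blast
    then show ?thesis using D across_closed[of \<tau> c] by (auto simp: edge_of_def)
  qed
  have "fst x = fst y" "emb (fst x) ` snd x = emb (fst x) ` snd y"
    using xy(3) by (auto simp: edge_emb_def split: prod.splits)
  then show "x = y"
    using inj_on_image_eq_iff[OF inj_emb sub sub] xy by (metis prod.collapse)
qed

text \<open>Inclusion-exclusion: the image of \<open>D\<close> and the block overlap in three
  vertices, three edges and the one triangle \<open>\<Delta>\<close> that is replaced, so the Euler
  characteristic 3 - 3 + 1 of a triangle is subtracted.\<close>

lemma euler_char_lift:
  assumes D: "D \<subseteq> triangles X"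
  shows "euler_char Z (lift D) = euler_char X D + (if \<Delta> \<in> D then euler_char Z B - 1 else 0)"
proof -
  let ?D = "D - {\<Delta>}"
  have finD: "finite D" using D finite_triangles finite_subset by blast
  have V: "vertices_in X D \<subseteq> vertices X" using D unfolding vertices_eq vertices_in_def by auto
  have V0: "vertices_in Z (e ` ?D) = v ` vertices_in X ?D"
  proof -
    have "(\<lambda>(\<tau>, c). corner Z \<tau> c) ` (e ` ?D \<times> UNIV) = (\<lambda>(\<tau>, c). corner Z (e \<tau>) c) ` (?D \<times> UNIV)"
      by force
    also have "\<dots> = (\<lambda>(\<tau>, c). v (corner X \<tau> c)) ` (?D \<times> UNIV)"
      using D corner_e by (intro image_cong) auto
    finally show ?thesis unfolding vertices_in_image by (simp add: image_image split_def)
  qed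
  have E0: "edges_in Z (e ` ?D) = edge_emb ` edges_in X ?D"
  proof -
    have "edge_of Z (e \<tau>) c = edge_emb (edge_of X \<tau> c)" if "\<tau> \<in> ?D" for \<tau> c
      using edge_emb_edge_of[of \<tau> c] that D by (auto simp: emb_def)
    then have "(\<lambda>(\<tau>, c). edge_of Z (e \<tau>) c) ` (?D \<times> UNIV) = (\<lambda>(\<tau>, c). edge_emb (edge_of X \<tau> c)) ` (?D \<times> UNIV)"
      by (intro image_cong) auto
    moreover have "edges_in Z (e ` ?D) = (\<lambda>(\<tau>, c). edge_of Z (e \<tau>) c) ` (?D \<times> UNIV)"
      unfolding edges_in_def by force
    ultimately show ?thesis unfolding edges_in_image by (simp add: image_image split_def)
  qed
  have cv: "card (v ` vertices_in X D) = card (vertices_in X D)"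
    using inj_on_subset[OF inj_v V] by (rule card_image)
  have ce: "card (edge_emb ` edges_in X D) = card (edges_in X D)"
    using inj_edge_emb[OF D] by (rule card_image)
  have ct: "card (e ` ?D) = card ?D"
    by (rule card_image, rule inj_on_subset[OF inj_e]) (use D in auto)
  show ?thesis
  proof (cases "\<Delta> \<in> D")
    case False
    then have "?D = D" "lift D = e ` ?D" by (auto simp: lift_def)
    then show ?thesis using V0 E0 cv ce ct False unfolding euler_char_def by simp
  next
    case True
    have D_eq: "?D \<union> {\<Delta>} = D" using True by blast
    have lift: "lift D = e ` ?D \<union> B" using True by (simp add: lift_def)
    have fin_v: "finite (v ` vertices_in X D)" by (simp add: finite_vertices_in finD)
    have fin_e: "finite (edge_emb ` edges_in X D)" by (simp add: finite_edges_in finD)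
    note fin_B = finite_vertices_in[OF finite_B, of Z] finite_edges_in[OF finite_B, of Z]
    have pB: "v (corner X \<Delta> d) \<in> vertices_in Z B" for d
    proof -
      obtain c where "d \<noteq> c" using other_colors by metis
      then show ?thesis using corner_p[of d c] corner_in_vertices_in[OF p_in[of c], of Z d] by simp
    qed
    have VD: "vertices_in X D = vertices_in X ?D \<union> range (corner X \<Delta>)"
      using vertices_in_Un[of X ?D "{\<Delta>}"] D_eq by (simp add: vertices_in_singleton)
    have "vertices_in Z (lift D) = vertices_in Z (e ` ?D) \<union> vertices_in Z B"
      unfolding lift by (rule vertices_in_Un)
    then have VL: "vertices_in Z (lift D) = v ` vertices_in X D \<union> vertices_in Z B"
      unfolding V0 VD using pB by auto
    have "v ` vertices_in X D \<inter> vertices_in Z B = v ` range (corner X \<Delta>)"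
      using vertices_B V VD pB by auto
    moreover have "card (v ` range (corner X \<Delta>)) = 3"
      using card_image[OF inj_on_subset[OF inj_v]] card_corners[OF \<Delta>] V VD by auto
    ultimately have cV: "card (v ` vertices_in X D) + card (vertices_in Z B) = card (vertices_in Z (lift D)) + 3"
      using card_Un_Int[OF fin_v fin_B(1)] VL by simp
    have ED: "edges_in X D = edges_in X ?D \<union> range (edge_of X \<Delta>)"
      using edges_in_Un[of X ?D "{\<Delta>}"] D_eq by (simp add: edges_in_singleton)
    have eB: "edge_emb (edge_of X \<Delta> c) \<in> edges_in Z B" for c
      using edge_of_in_edges_in[OF p_in[of c], of Z c] by (simp add: edge_emb_edge_of[OF \<Delta>] emb_def)
    have "edges_in Z (lift D) = edges_in Z (e ` ?D) \<union> edges_in Z B"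
      unfolding lift by (rule edges_in_Un)
    then have EL: "edges_in Z (lift D) = edge_emb ` edges_in X D \<union> edges_in Z B"
      unfolding E0 ED using eB by auto
    \<comment> \<open>An edge of the block has one of its triangles there, and the only triangle of
      \<open>X\<close> represented in the block is \<open>\<Delta>\<close>.\<close>
    have shared: "x \<in> range (edge_of X \<Delta>)" if x: "x \<in> edges_in X D" "edge_emb x \<in> edges_in Z B" for x
    proof -
      obtain \<tau> c where \<tau>: "x = edge_of X \<tau> c" "\<tau> \<in> triangles X"
        using x(1) D unfolding edges_in_def by blast
      obtain \<beta> d where \<beta>: "\<beta> \<in> B" "edge_of Z \<beta> d = edge_of Z (emb c \<tau>) c"
        using x(2) unfolding \<tau>(1) edge_emb_edge_of[OF \<tau>(2)] edges_in_def by auto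
      then have "\<beta> = emb c \<tau> \<or> \<beta> = emb c (across X \<tau> c)"
        using across_emb[OF \<tau>(2)] by (auto simp: edge_of_def)
      then have "\<tau> = \<Delta> \<or> across X \<tau> c = \<Delta>"
        using emb_in_B_iff \<beta>(1) \<tau>(2) across_closed by blast
      then show ?thesis using \<tau>(1) edge_of_across[OF \<tau>(2), of c] by (metis rangeI)
    qed
    have "edge_emb ` edges_in X D \<inter> edges_in Z B = edge_emb ` range (edge_of X \<Delta>)"
    proof
      show "edge_emb ` edges_in X D \<inter> edges_in Z B \<subseteq> edge_emb ` range (edge_of X \<Delta>)"
        using shared by blast
      show "edge_emb ` range (edge_of X \<Delta>) \<subseteq> edge_emb ` edges_in X D \<inter> edges_in Z B"
        using ED eB by blast
    qed
    moreover have "inj (edge_of X \<Delta>)" by (rule injI) (simp add: edge_of_def)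
    then have "card (range (edge_of X \<Delta>)) = 3" by (simp add: card_image)
    then have "card (edge_emb ` range (edge_of X \<Delta>)) = 3"
      using card_image[OF inj_on_subset[OF inj_edge_emb[OF D]]] ED by auto
    ultimately have cE: "card (edge_emb ` edges_in X D) + card (edges_in Z B) = card (edges_in Z (lift D)) + 3"
      using card_Un_Int[OF fin_e fin_B(2)] EL by simp
    have "e ` ?D \<inter> B = {}" using e_notin D by auto
    then have cF: "card (lift D) = card ?D + card B"
      unfolding lift using card_Un_disjoint[of "e ` ?D" B] ct finD finite_B by simp
    have cD: "card D = Suc (card ?D)" using card.remove[OF finD True] .
    have "euler_char Z (lift D) = euler_char X D + (euler_char Z B - 1)"
      unfolding euler_char_def using cV cE cv ce cF cD by linarith
    then show ?thesis using True by simp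
  qed
qed

section \<open>Lifting and descending clock disks\<close>

lemma white_e_iff:
  "\<tau> \<in> triangles X \<Longrightarrow> \<tau> \<noteq> \<Delta> \<Longrightarrow> e \<tau> \<in> white_triangles Z \<longleftrightarrow> \<tau> \<in> white_triangles X"
  by (auto simp: white_triangles_def black_triangles_def cw_e triangles_Z)

text \<open>The last hypothesis makes the correction in \<open>euler_char_lift\<close> vanish. It
  holds for the block from a planar trinity; for the other block its premise is refuted by
  \<open>clock_disk_avoids_outer\<close>.\<close>

lemma clock_disk_lift:
  assumes cd: "clock_disk X D u W" and W: "\<And>i. i < 3 \<Longrightarrow> W i \<noteq> \<Delta>"
    and B: "\<Delta> \<in> D \<Longrightarrow> euler_char Z B = 1"
  shows "clock_disk Z (lift D) (v \<circ> u) (e \<circ> W)"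
proof -
  obtain \<sigma> c where D: "D \<subseteq> triangles X" "edge_connected X D" "euler_char X D = 1" "inj_on u {..<3}"
    and bd: "boundary_sides X D = (\<lambda>i. (\<sigma> i, c i)) ` {..<3}"
    and all: "\<forall>i<3. corner X (\<sigma> i) (cw X (\<sigma> i) (c i)) = u i \<and>
      corner X (\<sigma> i) (cw X (\<sigma> i) (cw X (\<sigma> i) (c i))) = u (Suc i mod 3) \<and>
      across X (\<sigma> i) (c i) = W i" "\<forall>i<3. W i \<in> white_triangles X"
    using cd by (rule clock_diskE)
  have \<sigma>: "corner X (\<sigma> i) (cw X (\<sigma> i) (c i)) = u i"
    "corner X (\<sigma> i) (cw X (\<sigma> i) (cw X (\<sigma> i) (c i))) = u (Suc i mod 3)"
    "across X (\<sigma> i) (c i) = W i"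
    and white: "W i \<in> white_triangles X" if "i < 3" for i
    using all that by simp_all
  have \<sigma>X: "\<sigma> i \<in> triangles X" if "i < 3" for i
  proof -
    have "(\<sigma> i, c i) \<in> boundary_sides X D" using bd that by auto
    then show ?thesis using D by (auto simp: boundary_sides_def)
  qed
  have "u ` {..<3} \<subseteq> vertices X"
  proof clarify
    fix i :: nat assume "i < 3"
    then show "u i \<in> vertices X"
      using \<sigma>(1)[of i] corner_in_vertices_in[OF \<sigma>X[of i]] unfolding vertices_eq by metis
  qed
  then have inj: "inj_on (v \<circ> u) {..<3}"
    using comp_inj_on D(4) inj_on_subset[OF inj_v] by blast
  have "boundary_sides Z (lift D) = (\<lambda>i. (emb (c i) (\<sigma> i), c i)) ` {..<3}"
    unfolding boundary_sides_lift[OF D(1)] bd by (simp add: image_image)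
  moreover have "corner Z (emb (c i) (\<sigma> i)) (cw Z (emb (c i) (\<sigma> i)) (c i)) = (v \<circ> u) i \<and>
      corner Z (emb (c i) (\<sigma> i)) (cw Z (emb (c i) (\<sigma> i)) (cw Z (emb (c i) (\<sigma> i)) (c i))) = (v \<circ> u) (Suc i mod 3) \<and>
      across Z (emb (c i) (\<sigma> i)) (c i) = (e \<circ> W) i" if "i < 3" for i
    using \<sigma>[OF that] \<sigma>X[OF that] cw_cyclic[OF \<sigma>X[OF that], of "c i"] W[OF that]
    by (simp add: cw_emb corner_emb across_emb) (simp add: emb_def)
  moreover have "(e \<circ> W) i \<in> white_triangles Z" if "i < 3" for i
    using white[OF that] W[OF that] white_e_iff white_triangle_in by simp
  moreover have "euler_char Z (lift D) = 1" using euler_char_lift[OF D(1)] D(3) B by simp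
  ultimately show ?thesis
    unfolding clock_disk_def
    using D inj lift_subset edge_connected_lift_iff
    by (intro conjI exI[of _ "\<lambda>i. emb (c i) (\<sigma> i)"] exI[of _ c]) auto
qed

text \<open>Every side by which \<open>E\<close> can be left leads to some \<open>W i\<close>,
  outside \<open>B\<close>. So \<open>E\<close> cannot be left within the connected block and
  contains all or nothing of it. The final conclusion is conditional because collapsing may change
  the Euler characteristic.\<close>

lemma clock_disk_descend:
  assumes cd: "clock_disk Z E u W" and W: "\<And>i. i < 3 \<Longrightarrow> W i \<notin> B"
  obtains D u' W' where "D \<subseteq> triangles X" "edge_connected X D" "E = lift D"
    "\<And>i. i < 3 \<Longrightarrow> u i = v (u' i)" "\<And>i. i < 3 \<Longrightarrow> W i = e (W' i)" 
    "\<And>i. i < 3 \<Longrightarrow> u' i \<in> vertices X" "\<And>i. i < 3 \<Longrightarrow> W' i \<in> white_triangles X - {\<Delta>}"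
    "euler_char X D = 1 \<Longrightarrow> clock_disk X D u' W'"
proof -
  obtain \<sigma> c where E: "E \<subseteq> triangles Z" "edge_connected Z E" "euler_char Z E = 1" "inj_on u {..<3}"
    and bd: "boundary_sides Z E = (\<lambda>i. (\<sigma> i, c i)) ` {..<3}"
    and all: "\<forall>i<3. corner Z (\<sigma> i) (cw Z (\<sigma> i) (c i)) = u i \<and>
      corner Z (\<sigma> i) (cw Z (\<sigma> i) (cw Z (\<sigma> i) (c i))) = u (Suc i mod 3) \<and>
      across Z (\<sigma> i) (c i) = W i" "\<forall>i<3. W i \<in> white_triangles Z"
    using cd by (rule clock_diskE)
  have \<sigma>: "corner Z (\<sigma> i) (cw Z (\<sigma> i) (c i)) = u i"
    "corner Z (\<sigma> i) (cw Z (\<sigma> i) (cw Z (\<sigma> i) (c i))) = u (Suc i mod 3)"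
    "across Z (\<sigma> i) (c i) = W i"
    and white: "W i \<in> white_triangles Z" if "i < 3" for i
    using all that by simp_all
  have out: "across Z \<beta> d \<notin> B" if "(\<beta>, d) \<in> boundary_sides Z E" for \<beta> d
    using that bd \<sigma> W by auto
  have "B \<subseteq> E" if "E \<inter> B \<noteq> {}"
  proof -
    have "E \<inter> B = B"
      by (rule edge_connectedD[OF connected_B]) (use that out in \<open>auto simp: boundary_sides_def\<close>)
    then show ?thesis by auto
  qed
  then obtain D where D: "D \<subseteq> triangles X" "E = lift D" using ex_lift[OF E(1)] by blast
  have conn: "edge_connected X D" using E(2) edge_connected_lift_iff[OF D(1)] D(2) by simp
  have "\<exists>\<tau>. \<tau> \<in> triangles X \<and> \<sigma> i = emb (c i) \<tau> \<and> (\<tau>, c i) \<in> boundary_sides X D" if "i < 3" for i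
  proof -
    have "(\<sigma> i, c i) \<in> boundary_sides Z (lift D)" using bd that D(2) by auto
    then show ?thesis unfolding boundary_sides_lift[OF D(1)] using D(1) by (auto simp: boundary_sides_def)
  qed
  then obtain \<rho> where \<rho>: "\<And>i. i < 3 \<Longrightarrow> \<rho> i \<in> triangles X \<and> \<sigma> i = emb (c i) (\<rho> i) \<and> (\<rho> i, c i) \<in> boundary_sides X D"
    by metis
  define u' where "u' i = corner X (\<rho> i) (cw X (\<rho> i) (c i))" for i
  define W' where "W' i = across X (\<rho> i) (c i)" for i
  have u: "u i = v (u' i)" "u (Suc i mod 3) = v (corner X (\<rho> i) (cw X (\<rho> i) (cw X (\<rho> i) (c i))))" if "i < 3" for i
    using \<sigma>[OF that] \<rho>[OF that] cw_cyclic[of "\<rho> i" "c i"] unfolding u'_def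
    by (auto simp: cw_emb corner_emb)
  have W_emb: "W i = emb (c i) (W' i)" "W' i \<in> triangles X" if "i < 3" for i
    using \<sigma>[OF that] \<rho>[OF that] across_closed unfolding W'_def by (auto simp: across_emb)
  have W'_neq: "W' i \<noteq> \<Delta>" if "i < 3" for i
    using W_emb[OF that] W[OF that] emb_in_B_iff by metis
  have We: "W i = e (W' i)" if "i < 3" for i
    using W_emb[OF that] W'_neq[OF that] by (simp add: emb_def)
  have W'_white: "W' i \<in> white_triangles X" if "i < 3" for i
    using white[OF that] white_e_iff[OF W_emb(2)[OF that] W'_neq[OF that]] We[OF that] by simp
  have u'_in: "u' i \<in> vertices X" if "i < 3" for i
    using \<rho>[OF that] unfolding u'_def vertices_eq vertices_in_def by auto
  have bd': "boundary_sides X D = (\<lambda>i. (\<rho> i, c i)) ` {..<3}"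
  proof (intro equalityI subrelI)
    fix \<tau> d assume *: "(\<tau>, d) \<in> boundary_sides X D"
    then have "(emb d \<tau>, d) \<in> (\<lambda>i. (\<sigma> i, c i)) ` {..<3}"
      unfolding bd[symmetric] D(2) boundary_sides_lift[OF D(1)] by force
    then obtain i where i: "i < 3" "emb d \<tau> = \<sigma> i" "d = c i" by auto
    then have "\<tau> = \<rho> i"
      using \<rho>[OF i(1)] inj_onD[OF inj_emb] * D(1) by (auto simp: boundary_sides_def)
    then show "(\<tau>, d) \<in> (\<lambda>i. (\<rho> i, c i)) ` {..<3}" using i by auto
  qed (use \<rho> in auto)
  have step: "corner X (\<rho> i) (cw X (\<rho> i) (cw X (\<rho> i) (c i))) = u' (Suc i mod 3)" if "i < 3" for i
  proof (rule inj_onD[OF inj_v])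
    have "Suc i mod 3 < 3" by simp
    then show "v (corner X (\<rho> i) (cw X (\<rho> i) (cw X (\<rho> i) (c i)))) = v (u' (Suc i mod 3))"
      using u(1)[of "Suc i mod 3"] u(2)[OF that] by simp
    show "u' (Suc i mod 3) \<in> vertices X" by (rule u'_in) simp
    show "corner X (\<rho> i) (cw X (\<rho> i) (cw X (\<rho> i) (c i))) \<in> vertices X"
      using \<rho>[OF that] unfolding vertices_eq vertices_in_def by auto
  qed
  have inj: "inj_on u' {..<3}"
  proof (rule inj_onI)
    fix i j assume "i \<in> {..<3::nat}" "j \<in> {..<3}" "u' i = u' j"
    then show "i = j" using u(1)[of i] u(1)[of j] inj_onD[OF E(4), of i j] by simp
  qed
  have "clock_disk X D u' W'" if "euler_char X D = 1"
    unfolding clock_disk_def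
    using D(1) conn that inj bd' step W'_white
    by (intro conjI exI[of _ \<rho>] exI[of _ c]) (auto simp: u'_def W'_def)
  then show thesis
    using that[OF D(1) conn D(2) u(1) We u'_in] W'_white W'_neq by blast
qed

end

section \<open>States and the outer triangle\<close>

lemma bij_betw_fst_iff:
  "bij_betw fst M A \<longleftrightarrow> (\<forall>w v. (w, v) \<in> M \<longrightarrow> w \<in> A) \<and> (\<forall>w\<in>A. \<exists>!v. (w, v) \<in> M)"
proof
  assume "bij_betw fst M A"
  then have inj: "inj_on fst M" and im: "fst ` M = A" by (auto simp: bij_betw_def)
  have "\<exists>!v. (w, v) \<in> M" if A: "w \<in> A" for w
  proof -
    obtain v where "(w, v) \<in> M" using A im by force
    then show ?thesis using inj_onD[OF inj] by fastforce
  qed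
  moreover have "w \<in> A" if "(w, v) \<in> M" for w v using that im by force
  ultimately show "(\<forall>w v. (w, v) \<in> M \<longrightarrow> w \<in> A) \<and> (\<forall>w\<in>A. \<exists>!v. (w, v) \<in> M)" by blast
next
  assume *: "(\<forall>w v. (w, v) \<in> M \<longrightarrow> w \<in> A) \<and> (\<forall>w\<in>A. \<exists>!v. (w, v) \<in> M)"
  then have "inj_on fst M" by (intro inj_onI) (auto, blast)
  moreover have "fst ` M = A"
  proof
    show "fst ` M \<subseteq> A" using * by auto
    show "A \<subseteq> fst ` M" using * by force
  qed
  ultimately show "bij_betw fst M A" by (simp add: bij_betw_def)
qed

lemma bij_betw_snd_iff:
  "bij_betw snd M A \<longleftrightarrow> (\<forall>w v. (w, v) \<in> M \<longrightarrow> v \<in> A) \<and> (\<forall>v\<in>A. \<exists>!w. (w, v) \<in> M)"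
proof
  assume "bij_betw snd M A"
  then have inj: "inj_on snd M" and im: "snd ` M = A" by (auto simp: bij_betw_def)
  have "\<exists>!w. (w, v) \<in> M" if A: "v \<in> A" for v
  proof -
    obtain w where "(w, v) \<in> M" using A im by force
    then show ?thesis using inj_onD[OF inj] by fastforce
  qed
  moreover have "v \<in> A" if "(w, v) \<in> M" for w v using that im by force
  ultimately show "(\<forall>w v. (w, v) \<in> M \<longrightarrow> v \<in> A) \<and> (\<forall>v\<in>A. \<exists>!w. (w, v) \<in> M)" by blast
next
  assume *: "(\<forall>w v. (w, v) \<in> M \<longrightarrow> v \<in> A) \<and> (\<forall>v\<in>A. \<exists>!w. (w, v) \<in> M)"
  then have "inj_on snd M" by (intro inj_onI) (auto, blast)
  moreover have "snd ` M = A"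
  proof
    show "snd ` M \<subseteq> A" using * by auto
    show "A \<subseteq> snd ` M" using * by force
  qed
  ultimately show "bij_betw snd M A" by (simp add: bij_betw_def)
qed

lemma states_iff:
  "M \<in> states X \<longleftrightarrow>
    (\<forall>w v. (w, v) \<in> M \<longrightarrow> w \<in> white_triangles X - set_option (outer X) \<and>
      v \<in> vertices X - roots X \<and> (\<exists>c. v = corner X w c)) \<and>
    (\<forall>w\<in>white_triangles X - set_option (outer X). \<exists>!v. (w, v) \<in> M) \<and>
    (\<forall>v\<in>vertices X - roots X. \<exists>!w. (w, v) \<in> M)"
  unfolding states_def bij_betw_fst_iff bij_betw_snd_iff by fast

lemma cw_pairs_mem_iff: "x \<in> cw_pairs u W \<longleftrightarrow> (\<exists>i<3. x = (W i, u (Suc i mod 3)))"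
  by (auto simp: cw_pairs_def)

lemma cw_pairs_map_prod:
  assumes "\<And>i. i < 3 \<Longrightarrow> u i = f (u' i)" "\<And>i. i < 3 \<Longrightarrow> W i = g (W' i)"
  shows "cw_pairs u W = map_prod g f ` cw_pairs u' W'"
  using assms by (simp add: cw_pairs_def image_image)

lemma ccw_pairs_map_prod:
  assumes "\<And>i. i < 3 \<Longrightarrow> u i = f (u' i)" "\<And>i. i < 3 \<Longrightarrow> W i = g (W' i)"
  shows "ccw_pairs u W = map_prod g f ` ccw_pairs u' W'"
  using assms by (simp add: ccw_pairs_def image_image)

section \<open>Counting in planar trinities\<close>

context planar_trinity
begin

lemma card_roots: "outer X = Some \<omega> \<Longrightarrow> card (roots X) = 3"
proof -
  assume "outer X = Some \<omega>"
  then show ?thesis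
    using outer_white card_corners white_triangle_in by (auto simp: roots_def vertices_in_singleton)
qed

text \<open>On a sphere there are w + 2 vertices for w white triangles; removing three roots leaves
  w - 1.\<close>

lemma card_white_non_outer:
  assumes "outer X = Some \<omega>"
  shows "card (white_triangles X - {\<omega>}) = card (vertices X - roots X)"
proof -
  have \<omega>: "\<omega> \<in> white_triangles X" using assms outer_white by auto
  then have "roots X \<subseteq> vertices X"
    using assms white_triangle_in unfolding roots_def vertices_eq vertices_in_def by auto
  moreover have "finite (vertices X)" using finite_triangles by (simp add: vertices_eq finite_vertices_in)
  ultimately have "card (vertices X - roots X) = card (vertices X) - 3"
    using card_roots[OF assms] by (simp add: card_Diff_subset finite_subset)
  moreover have "finite (white_triangles X)" using finite_triangles by (simp add: white_triangles_def)
  then have "card (white_triangles X) = Suc (card (white_triangles X - {\<omega>}))"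
    using \<omega> by (rule card.remove)
  ultimately show ?thesis using card_vertices sphere by linarith
qed

text \<open>
  If \<open>D\<close> contained the outer triangle, then its \<open>w - 1\<close> other white triangles would have to be matched
  to vertices of \<open>D\<close> that are neither roots nor among the \<open>u i\<close>, of which there are only \<open>w - 3\<close>.
\<close>

lemma clock_disk_avoids_outer:
  assumes outer: "outer X = Some \<omega>" and s: "s \<in> states X"
    and cd: "clock_disk X D u W" and cw: "cw_pairs u W \<subseteq> s"
  shows "\<omega> \<notin> D"
proof
  assume \<omega>D: "\<omega> \<in> D"
  have \<omega>: "\<omega> \<in> white_triangles X" using outer outer_white by auto
  obtain \<sigma> c where D: "D \<subseteq> triangles X" "edge_connected X D" "euler_char X D = 1" "inj_on u {..<3}"
    and bd: "boundary_sides X D = (\<lambda>i. (\<sigma> i, c i)) ` {..<3}"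
    and all: "\<forall>i<3. corner X (\<sigma> i) (cw X (\<sigma> i) (c i)) = u i \<and>
      corner X (\<sigma> i) (cw X (\<sigma> i) (cw X (\<sigma> i) (c i))) = u (Suc i mod 3) \<and>
      across X (\<sigma> i) (c i) = W i" "\<forall>i<3. W i \<in> white_triangles X"
    using cd by (rule clock_diskE)
  have \<sigma>: "corner X (\<sigma> i) (cw X (\<sigma> i) (c i)) = u i"
    "corner X (\<sigma> i) (cw X (\<sigma> i) (cw X (\<sigma> i) (c i))) = u (Suc i mod 3)"
    "across X (\<sigma> i) (c i) = W i"
    and white: "W i \<in> white_triangles X" if "i < 3" for i
    using all that by simp_all
  note fin = finite_subset_triangles[OF D(1)]
  have side: "\<sigma> i \<in> D" "W i \<notin> D" if "i < 3" for i
  proof -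
    have "(\<sigma> i, c i) \<in> boundary_sides X D" using bd that by auto
    then show "\<sigma> i \<in> D" "W i \<notin> D" using \<sigma>[OF that] by (auto simp: boundary_sides_def)
  qed
  have "\<tau> \<in> black_triangles X" if bdry: "(\<tau>, d) \<in> boundary_sides X D" for \<tau> d
  proof -
    obtain i where "i < 3" "\<tau> = \<sigma> i" "d = c i" using bdry bd by auto
    then show ?thesis
      using white[of i] \<sigma>[of i] side(1)[of i] D(1) across_black_iff[of \<tau> d] white_not_black by auto
  qed
  then have "3 * int (card (vertices_in X D)) =
    3 + 3 * int (card (D \<inter> white_triangles X)) + 2 * int (card (boundary_sides X D))"
    using vertex_count[OF D(1)] D(3) by simp
  moreover have "card (boundary_sides X D) \<le> 3"
    unfolding bd using card_image_le[of "{..<3::nat}"] by simp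
  \<comment> \<open>With w white triangles in \<open>D\<close> and k \<le> 3 boundary sides, 3 + 3w
    + 2k \<le> 3 (w + 3).\<close>
  ultimately have V: "card (vertices_in X D) \<le> card (D \<inter> white_triangles X) + 3" by linarith
  \<comment> \<open>\<open>(i + 2) mod 3\<close> is the cyclic predecessor of \<open>i\<close>,
    written without subtraction on \<open>nat\<close>: before the move, \<open>u i\<close> is
    matched to the triangle preceding it.\<close>
  have partner: "(W ((i + 2) mod 3), u i) \<in> s" if "i < 3" for i
  proof -
    have "Suc ((i + 2) mod 3) mod 3 = i" "(i + 2) mod 3 < 3" using that by presburger+
    then show ?thesis using cw cw_pairs_mem_iff by (metis subsetD)
  qed
  have u_nonroot: "u i \<notin> roots X" if "i < 3" for i
    using partner[OF that] s unfolding states_iff by blast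
  have roots_D: "roots X \<subseteq> vertices_in X D"
    using outer \<omega>D unfolding roots_def vertices_in_def by auto
  have u_D: "u ` {..<3} \<subseteq> vertices_in X D"
  proof clarify
    fix i :: nat assume "i < 3"
    then show "u i \<in> vertices_in X D" using \<sigma>(1)[of i] corner_in_vertices_in[OF side(1)[of i]] by metis
  qed
  have "card (roots X \<union> u ` {..<3}) = card (roots X) + card (u ` {..<3})"
    using u_nonroot finite_subset[OF roots_D finite_vertices_in[OF fin]]
    by (intro card_Un_disjoint) auto
  then have six: "card (roots X \<union> u ` {..<3}) = 6"
    using card_roots[OF outer] card_image[OF D(4)] by simp
  have fin_V: "finite (vertices_in X D)" by (rule finite_vertices_in[OF fin])
  have sub: "roots X \<union> u ` {..<3} \<subseteq> vertices_in X D" using roots_D u_D by blast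
  let ?N = "D \<inter> white_triangles X - {\<omega>}"
  have "\<exists>v. (w, v) \<in> s" if "w \<in> ?N" for w
    using that s outer unfolding states_iff by auto
  then obtain m where m: "\<And>w. w \<in> ?N \<Longrightarrow> (w, m w) \<in> s" by metis
  have uniq: "w = w'" if "(w, x) \<in> s" "(w', x) \<in> s" for w w' x
    using that s unfolding states_iff by blast
  have "inj_on m ?N" by (rule inj_onI) (use m uniq in metis)
  moreover have "m ` ?N \<subseteq> vertices_in X D - (roots X \<union> u ` {..<3})"
  proof (rule image_subsetI)
    fix w assume "w \<in> ?N"
    then have w: "w \<in> D" "w \<in> white_triangles X" "w \<noteq> \<omega>" by auto
    then have mw: "(w, m w) \<in> s" using m by auto
    then have "m w \<notin> roots X" "\<exists>c. m w = corner X w c" using s unfolding states_iff by blast+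
    moreover have "m w \<noteq> u i" if i: "i < 3" for i
    proof
      assume "m w = u i"
      then have "w = W ((i + 2) mod 3)" using uniq mw partner[OF i] by metis
      then show False using side(2)[of "(i + 2) mod 3"] w by simp
    qed
    ultimately show "m w \<in> vertices_in X D - (roots X \<union> u ` {..<3})"
      using corner_in_vertices_in[OF w(1)] by auto
  qed
  ultimately have "card ?N \<le> card (vertices_in X D - (roots X \<union> u ` {..<3}))"
    by (rule card_inj_on_le) (simp add: fin_V)
  also have "\<dots> = card (vertices_in X D) - 6"
    using card_Diff_subset[OF finite_subset[OF sub fin_V] sub] six by simp
  finally have "card ?N \<le> card (vertices_in X D) - 6" .
  moreover have "card (D \<inter> white_triangles X) = Suc (card ?N)"
    by (rule card.remove) (use fin \<omega> \<omega>D in auto)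
  \<comment> \<open>This keeps the subtraction of 6 from being truncated.\<close>
  moreover have "6 \<le> card (vertices_in X D)"
    using six card_mono[OF fin_V sub] by simp
  ultimately show False using V by linarith
qed

end

section \<open>Restricting and joining sets of pairs\<close>

lemma restrict_left_iff [simp]: "(w, v) \<in> restrict_left M \<longleftrightarrow> (Inl w, Inl v) \<in> M"
  by (simp add: restrict_left_def)

lemma restrict_right_iff [simp]: "(w, v) \<in> restrict_right M \<longleftrightarrow> (Inr w, Inr v) \<in> M"
  by (simp add: restrict_right_def)

lemma restrict_join:
  "restrict_left (map_prod Inl Inl ` s \<union> map_prod Inr Inr ` s') = s"
  "restrict_right (map_prod Inl Inl ` s \<union> map_prod Inr Inr ` s') = s'"
  by (auto simp: restrict_left_def restrict_right_def)

lemma restrict_update_left: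
  "restrict_left (S - map_prod Inl Inl ` P \<union> map_prod Inl Inl ` Q) = restrict_left S - P \<union> Q"
  "restrict_right (S - map_prod Inl Inl ` P \<union> map_prod Inl Inl ` Q) = restrict_right S"
  by (auto simp: restrict_left_def restrict_right_def)

lemma restrict_update_right:
  "restrict_right (S - map_prod Inr Inr ` P \<union> map_prod Inr Inr ` Q) = restrict_right S - P \<union> Q"
  "restrict_left (S - map_prod Inr Inr ` P \<union> map_prod Inr Inr ` Q) = restrict_left S"
  by (auto simp: restrict_left_def restrict_right_def)

lemma state_pairD:
  assumes "M \<in> states X" "(w, v) \<in> M"
  shows "w \<in> white_triangles X - set_option (outer X)" "v \<in> vertices X - roots X" "\<exists>c. v = corner X w c"
  using assms unfolding states_iff by blast+

lemma state_ex_vertex: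
  "M \<in> states X \<Longrightarrow> w \<in> white_triangles X - set_option (outer X) \<Longrightarrow> \<exists>v. (w, v) \<in> M"
  unfolding states_iff by blast

lemma state_ex_triangle: "M \<in> states X \<Longrightarrow> v \<in> vertices X - roots X \<Longrightarrow> \<exists>w. (w, v) \<in> M"
  unfolding states_iff by blast

lemma state_vertex_unique: "M \<in> states X \<Longrightarrow> (w, v) \<in> M \<Longrightarrow> (w, v') \<in> M \<Longrightarrow> v = v'"
  unfolding states_iff by blast

lemma state_triangle_unique: "M \<in> states X \<Longrightarrow> (w, v) \<in> M \<Longrightarrow> (w', v) \<in> M \<Longrightarrow> w = w'"
  unfolding states_iff by blast

lemma stateI:
  assumes "\<And>w v. (w, v) \<in> M \<Longrightarrow> w \<in> white_triangles X - set_option (outer X)"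
    and "\<And>w v. (w, v) \<in> M \<Longrightarrow> v \<in> vertices X - roots X"
    and "\<And>w v. (w, v) \<in> M \<Longrightarrow> \<exists>c. v = corner X w c"
    and "\<And>w. w \<in> white_triangles X - set_option (outer X) \<Longrightarrow> \<exists>v. (w, v) \<in> M"
    and "\<And>v. v \<in> vertices X - roots X \<Longrightarrow> \<exists>w. (w, v) \<in> M"
    and "\<And>w v v'. (w, v) \<in> M \<Longrightarrow> (w, v') \<in> M \<Longrightarrow> v = v'"
    and "\<And>w w' v. (w, v) \<in> M \<Longrightarrow> (w', v) \<in> M \<Longrightarrow> w = w'"
  shows "M \<in> states X"
  unfolding states_iff
proof (intro conjI allI impI ballI)
  show "\<exists>!v. (w, v) \<in> M" if "w \<in> white_triangles X - set_option (outer X)" for w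
    using assms(4)[OF that] assms(6) by (rule ex_ex1I)
  show "\<exists>!w. (w, v) \<in> M" if "v \<in> vertices X - roots X" for v
    using assms(5)[OF that] assms(7) by (rule ex_ex1I)
qed (use assms(1-3) in blast)+

section \<open>Connected sums\<close>

text \<open>Planar and toric \<open>X\<close> are treated together; the two possible Euler
  characteristics of \<open>X\<close> enter only as a hypothesis of
  \<open>move_cases\<close>.\<close>

locale connected_sum = X: trinity X + Y: planar_trinity Y
  for X :: "('t, 'v) trinity_data" and Y :: "('a, 'b) trinity_data" +
  fixes \<Delta> :: 't and \<omega> :: 'a
  assumes \<Delta>_black: "\<Delta> \<in> black_triangles X"
    and outer_Y: "outer Y = Some \<omega>"
    and outer_X: "set_option (outer X) \<subseteq> white_triangles X"
begin

abbreviation Z :: "('t + 'a, 'v + 'b) trinity_data" where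
  "Z \<equiv> conn_sum X \<Delta> Y"

lemma triangles_Z: "triangles Z = Inl ` (triangles X - {\<Delta>}) \<union> Inr ` (triangles Y - {\<omega>})"
  and vertices_Z: "vertices Z = Inl ` vertices X \<union> Inr ` (vertices Y - roots Y)"
  and outer_Z: "outer Z = map_option Inl (outer X)"
  and corner_Inl [simp]: "corner Z (Inl \<tau>) c = Inl (corner X \<tau> c)"
  and corner_Inr: "corner Z (Inr \<rho>) c =
    (if corner Y \<rho> c \<in> roots Y then Inl (corner X \<Delta> c) else Inr (corner Y \<rho> c))"
  and across_Inl: "across Z (Inl \<tau>) c =
    (if across X \<tau> c = \<Delta> then Inr (across Y \<omega> c) else Inl (across X \<tau> c))"
  and across_Inr: "across Z (Inr \<rho>) c =
    (if across Y \<rho> c = \<omega> then Inl (across X \<Delta> c) else Inr (across Y \<rho> c))"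
  and cw_Inl [simp]: "cw Z (Inl \<tau>) = cw X \<tau>"
  and cw_Inr [simp]: "cw Z (Inr \<rho>) = cw Y \<rho>"
  by (auto simp: conn_sum_def Let_def outer_Y)

lemma \<omega>_white: "\<omega> \<in> white_triangles Y"
  using Y.outer_white outer_Y by auto

lemmas \<Delta>_in = X.black_triangle_in[OF \<Delta>_black] and \<omega>_in = Y.white_triangle_in[OF \<omega>_white]

lemma roots_Y: "roots Y = range (corner Y \<omega>)"
  by (simp add: roots_def outer_Y vertices_in_singleton)

text \<open>Gluing as seen from \<open>Y\<close>: a root is renamed to the corner of
  \<open>\<Delta>\<close> of its colour, and its colour is recovered by
  \<open>vcolor\<close>.\<close>

definition join_vertex :: "'b \<Rightarrow> 'v + 'b" where
  "join_vertex y = (if y \<in> roots Y then Inl (corner X \<Delta> (vcolor Y y)) else Inr y)"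

sublocale left: collapse X "conn_sum X \<Delta> Y" \<Delta> Inl Inl "Inr ` (triangles Y - {\<omega>})" "\<lambda>c. Inr (across Y \<omega> c)"
proof unfold_locales
  show "\<Delta> \<in> triangles X" by (rule \<Delta>_in)
  show "triangles Z = Inl ` (triangles X - {\<Delta>}) \<union> Inr ` (triangles Y - {\<omega>})" by (rule triangles_Z)
  show "finite (Inr ` (triangles Y - {\<omega>}))" using Y.finite_triangles by simp
  show "Inr (across Y \<omega> c) \<in> Inr ` (triangles Y - {\<omega>})" for c
    using Y.across_closed[OF \<omega>_in] Y.across_neq[OF \<omega>_in] by auto
  show "corner Z (Inr (across Y \<omega> c)) d = Inl (corner X \<Delta> d)" if "d \<noteq> c" for c d
    using Y.corner_across[OF \<omega>_in that] by (simp add: corner_Inr roots_Y)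
  show "across Z (Inr (across Y \<omega> c)) c = Inl (across X \<Delta> c)" for c
    using Y.across_invol[OF \<omega>_in] by (simp add: across_Inr)
  show "across Z \<beta> c \<in> Inr ` (triangles Y - {\<omega>}) \<or> \<beta> = Inr (across Y \<omega> c)"
    if \<beta>: "\<beta> \<in> Inr ` (triangles Y - {\<omega>})" for \<beta> c
  proof -
    obtain \<tau> where \<tau>: "\<tau> \<in> triangles Y" "\<beta> = Inr \<tau>" using \<beta> by blast
    show ?thesis
      using Y.across_closed[OF \<tau>(1), of c] Y.across_eq_iff[OF \<tau>(1) \<omega>_in, of c] \<tau>(2)
      by (cases "across Y \<tau> c = \<omega>") (simp_all add: across_Inr)
  qed
  \<comment> \<open>The neighbours of the white outer triangle are black, like
    \<open>\<Delta>\<close>.\<close>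
  show "cw Z (Inr (across Y \<omega> c)) = cw X \<Delta>" for c
    by (simp add: X.cw_eq_of_black[OF \<Delta>_black] Y.cw_eq_of_black[OF Y.across_of_white[OF \<omega>_white]])
  show "edge_connected Z (Inr ` (triangles Y - {\<omega>}))"
    by (rule edge_connected_image[OF Y.edge_connected_remove[OF \<omega>_in]]) (auto simp: across_Inr)
  show "x \<in> range (corner X \<Delta>)" if "Inl x \<in> vertices_in Z (Inr ` (triangles Y - {\<omega>}))" for x
    using that by (auto simp: vertices_in_def corner_Inr split: if_splits)
qed (auto simp: across_Inl)

lemma inj_join_vertex: "inj_on join_vertex (vertices Y)"
proof (rule inj_onI)
  fix y z assume eq: "join_vertex y = join_vertex z"
  show "y = z"
  proof (cases "y \<in> roots Y \<and> z \<in> roots Y")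
    case True
    then obtain c d where cd: "y = corner Y \<omega> c" "z = corner Y \<omega> d" unfolding roots_Y by blast
    then have "corner X \<Delta> c = corner X \<Delta> d"
      using True eq by (simp add: join_vertex_def Y.vcolor_corner[OF \<omega>_in])
    then have "c = d" by (rule injD[OF X.inj_corner[OF \<Delta>_in]])
    then show ?thesis using cd by simp
  next
    case False
    then show ?thesis using eq by (auto simp: join_vertex_def split: if_splits)
  qed
qed

text \<open>Seen from \<open>Y\<close>, the white triangle \<open>\<omega>\<close> is replaced by
  \<open>X\<close> minus \<open>\<Delta>\<close>, whose triangles along the gluing are white because
  \<open>\<Delta>\<close> is black.\<close>

sublocale right: collapse Y "conn_sum X \<Delta> Y" \<omega> Inr join_vertex "Inl ` (triangles X - {\<Delta>})" "\<lambda>c. Inl (across X \<Delta> c)"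
proof unfold_locales
  show "\<omega> \<in> triangles Y" by (rule \<omega>_in)
  show "triangles Z = Inr ` (triangles Y - {\<omega>}) \<union> Inl ` (triangles X - {\<Delta>})" using triangles_Z by auto
  show "finite (Inl ` (triangles X - {\<Delta>}))" using X.finite_triangles by simp
  show "inj_on join_vertex (vertices Y)" by (rule inj_join_vertex)
  show "Inl (across X \<Delta> c) \<in> Inl ` (triangles X - {\<Delta>})" for c
    using X.across_closed[OF \<Delta>_in] X.across_neq[OF \<Delta>_in] by auto
  show "corner Z (Inr \<tau>) c = join_vertex (corner Y \<tau> c)" if "\<tau> \<in> triangles Y" for \<tau> c
    using Y.vcolor_corner[OF that] by (simp add: corner_Inr join_vertex_def)
  show "corner Z (Inl (across X \<Delta> c)) d = join_vertex (corner Y \<omega> d)" if "d \<noteq> c" for c d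
    using X.corner_across[OF \<Delta>_in that] Y.vcolor_corner[OF \<omega>_in] by (simp add: join_vertex_def roots_Y)
  show "across Z (Inl (across X \<Delta> c)) c = Inr (across Y \<omega> c)" for c
    using X.across_invol[OF \<Delta>_in] by (simp add: across_Inl)
  show "across Z \<beta> c \<in> Inl ` (triangles X - {\<Delta>}) \<or> \<beta> = Inl (across X \<Delta> c)"
    if \<beta>: "\<beta> \<in> Inl ` (triangles X - {\<Delta>})" for \<beta> c
  proof -
    obtain \<tau> where \<tau>: "\<tau> \<in> triangles X" "\<beta> = Inl \<tau>" using \<beta> by blast
    show ?thesis
      using X.across_closed[OF \<tau>(1), of c] X.across_eq_iff[OF \<tau>(1) \<Delta>_in, of c] \<tau>(2)
      by (cases "across X \<tau> c = \<Delta>") (simp_all add: across_Inl)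
  qed
  show "cw Z (Inl (across X \<Delta> c)) = cw Y \<omega>" for c
    by (simp add: Y.cw_eq_of_white[OF \<omega>_white] X.cw_eq_of_white[OF X.across_of_black[OF \<Delta>_black]])
  show "edge_connected Z (Inl ` (triangles X - {\<Delta>}))"
    by (rule edge_connected_image[OF X.edge_connected_remove[OF \<Delta>_in]]) (auto simp: across_Inl)
  show "y \<in> range (corner Y \<omega>)" if "join_vertex y \<in> vertices_in Z (Inl ` (triangles X - {\<Delta>}))" for y
    using that by (auto simp: vertices_in_def join_vertex_def roots_Y[symmetric] split: if_splits)
qed (auto simp: across_Inr)

text \<open>The block is itself the lift of a set avoiding the collapsed triangle of its own
  summand, so its Euler characteristic can be computed there.\<close>

lemma euler_char_right_block: "euler_char Z (Inr ` (triangles Y - {\<omega>})) = 1"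
proof -
  have "right.lift (triangles Y - {\<omega>}) = Inr ` (triangles Y - {\<omega>})" by (simp add: right.lift_def)
  then show ?thesis
    using right.euler_char_lift[of "triangles Y - {\<omega>}"] Y.euler_char_remove[OF \<omega>_in] Y.sphere by simp
qed

lemma euler_char_left_block: "euler_char Z (Inl ` (triangles X - {\<Delta>})) = euler_char X (triangles X) - 1"
proof -
  have "left.lift (triangles X - {\<Delta>}) = Inl ` (triangles X - {\<Delta>})" by (simp add: left.lift_def)
  then show ?thesis
    using left.euler_char_lift[of "triangles X - {\<Delta>}"] X.euler_char_remove[OF \<Delta>_in] by simp
qed

section \<open>Splitting of states\<close>

lemma white_Z: "white_triangles Z = Inl ` white_triangles X \<union> Inr ` (white_triangles Y - {\<omega>})"
  using \<Delta>_black by (auto simp: white_triangles_def black_triangles_def triangles_Z)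

lemma matched_triangles_Z:
  "white_triangles Z - set_option (outer Z) =
    Inl ` (white_triangles X - set_option (outer X)) \<union> Inr ` (white_triangles Y - set_option (outer Y))"
  by (auto simp: white_Z outer_Z outer_Y option.set_map)

lemma matched_vertices_Z:
  "vertices Z - roots Z = Inl ` (vertices X - roots X) \<union> Inr ` (vertices Y - roots Y)"
proof -
  have "roots Z = Inl ` roots X"
    by (cases "outer X")
      (auto simp: roots_def outer_Z vertices_in_singleton, simp_all add: vertices_in_def)
  then show ?thesis by (auto simp: vertices_Z)
qed

text \<open>
  The triangles matched to non-root vertices of \<open>Y\<close> come from \<open>Y\<close>; there are as many of these vertices
  as non-outer white triangles of \<open>Y\<close>, so no such triangle is left over for a vertex of \<open>X\<close>.
\<close>

lemma state_pair_cases: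
  assumes S: "S \<in> states Z" and p: "(a, x) \<in> S"
  obtains (left) w v where "a = Inl w" "x = Inl v" | (right) w v where "a = Inr w" "x = Inr v"
proof -
  let ?W = "white_triangles Y - set_option (outer Y)" and ?V = "vertices Y - roots Y"
  \<comment> \<open>All corners of a triangle from \<open>X\<close> are vertices of
    \<open>X\<close>.\<close>
  have LR: False if wv: "(Inl w, Inr v) \<in> S" for w v
    using state_pairD(3)[OF S wv] by simp
  have "\<exists>w. w \<in> ?W \<and> (Inr w, Inr v) \<in> S" if v: "v \<in> ?V" for v
  proof -
    obtain b where b: "(b, Inr v) \<in> S"
      using state_ex_triangle[OF S, of "Inr v"] v unfolding matched_vertices_Z by blast
    then have "b \<in> Inr ` ?W"
      using state_pairD(1)[OF S b] LR unfolding matched_triangles_Z by blast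
    then show ?thesis using b by blast
  qed
  then obtain m where m: "\<And>v. v \<in> ?V \<Longrightarrow> m v \<in> ?W \<and> (Inr (m v), Inr v) \<in> S" by metis
  note uniq = state_vertex_unique[OF S]
  have "inj_on m ?V"
  proof (rule inj_onI)
    fix y z assume "y \<in> ?V" "z \<in> ?V" "m y = m z"
    then have "(Inr (m y), Inr y) \<in> S" "(Inr (m y), Inr z) \<in> S" using m[of y] m[of z] by simp_all
    then show "y = z" using uniq by blast
  qed
  then have "card (m ` ?V) = card ?W"
    using Y.card_white_non_outer[OF outer_Y] outer_Y by (simp add: card_image)
  moreover have "finite ?W" using Y.finite_triangles by (simp add: white_triangles_def)
  ultimately have onto: "m ` ?V = ?W" using m by (intro card_subset_eq) auto
  have RL: False if wv: "(Inr w, Inl v) \<in> S" for w v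
  proof -
    have "w \<in> ?W" using state_pairD(1)[OF S wv] unfolding matched_triangles_Z by blast
    then obtain y where "y \<in> ?V" "w = m y" using onto by blast
    then have "(Inr w, Inr y) \<in> S" using m by blast
    then show False using uniq[OF wv] by blast
  qed
  show thesis
  proof (cases a)
    case (Inl w)
    then show thesis using p LR left by (cases x) auto
  next
    case (Inr w)
    then show thesis using p RL right by (cases x) auto
  qed
qed

lemma state_decompose:
  assumes S: "S \<in> states Z"
  shows "S = map_prod Inl Inl ` restrict_left S \<union> map_prod Inr Inr ` restrict_right S"
proof (intro equalityI subrelI)
  fix a x assume "(a, x) \<in> S"
  with S show "(a, x) \<in> map_prod Inl Inl ` restrict_left S \<union> map_prod Inr Inr ` restrict_right S"
    by (cases rule: state_pair_cases) (use \<open>(a, x) \<in> S\<close> in force)+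
qed auto

lemma restrict_left_state:
  assumes S: "S \<in> states Z"
  shows "restrict_left S \<in> states X"
proof (rule stateI)
  fix w v assume "(w, v) \<in> restrict_left S"
  then have *: "(Inl w, Inl v) \<in> S" by simp
  show "w \<in> white_triangles X - set_option (outer X)"
    using state_pairD(1)[OF S *] unfolding matched_triangles_Z by blast
  show "v \<in> vertices X - roots X"
    using state_pairD(2)[OF S *] unfolding matched_vertices_Z by blast
  show "\<exists>c. v = corner X w c"
    using state_pairD(3)[OF S *] by simp
next
  fix w assume "w \<in> white_triangles X - set_option (outer X)"
  then obtain x where x: "(Inl w, x) \<in> S"
    using state_ex_vertex[OF S, of "Inl w"] unfolding matched_triangles_Z by blast
  with S show "\<exists>v. (w, v) \<in> restrict_left S"
    by (cases rule: state_pair_cases) (use x in auto)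
next
  fix v assume "v \<in> vertices X - roots X"
  then obtain a where a: "(a, Inl v) \<in> S"
    using state_ex_triangle[OF S, of "Inl v"] unfolding matched_vertices_Z by blast
  with S show "\<exists>w. (w, v) \<in> restrict_left S"
    by (cases rule: state_pair_cases) (use a in auto)
next
  show "v = v'" if "(w, v) \<in> restrict_left S" "(w, v') \<in> restrict_left S" for w v v'
    using that state_vertex_unique[OF S, of "Inl w" "Inl v" "Inl v'"] by simp
  show "w = w'" if "(w, v) \<in> restrict_left S" "(w', v) \<in> restrict_left S" for w w' v
    using that state_triangle_unique[OF S, of "Inl w" "Inl v" "Inl w'"] by simp
qed

lemma restrict_right_state:
  assumes S: "S \<in> states Z"
  shows "restrict_right S \<in> states Y"
proof (rule stateI)
  fix w v assume "(w, v) \<in> restrict_right S"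
  then have *: "(Inr w, Inr v) \<in> S" by simp
  show "w \<in> white_triangles Y - set_option (outer Y)"
    using state_pairD(1)[OF S *] unfolding matched_triangles_Z by blast
  show "v \<in> vertices Y - roots Y"
    using state_pairD(2)[OF S *] unfolding matched_vertices_Z by blast
  show "\<exists>c. v = corner Y w c"
    using state_pairD(3)[OF S *] by (auto simp: corner_Inr split: if_splits)
next
  fix w assume "w \<in> white_triangles Y - set_option (outer Y)"
  then obtain x where x: "(Inr w, x) \<in> S"
    using state_ex_vertex[OF S, of "Inr w"] unfolding matched_triangles_Z by blast
  with S show "\<exists>v. (w, v) \<in> restrict_right S"
    by (cases rule: state_pair_cases) (use x in auto)
next
  fix v assume "v \<in> vertices Y - roots Y"
  then obtain a where a: "(a, Inr v) \<in> S"
    using state_ex_triangle[OF S, of "Inr v"] unfolding matched_vertices_Z by blast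
  with S show "\<exists>w. (w, v) \<in> restrict_right S"
    by (cases rule: state_pair_cases) (use a in auto)
next
  show "v = v'" if "(w, v) \<in> restrict_right S" "(w, v') \<in> restrict_right S" for w v v'
    using that state_vertex_unique[OF S, of "Inr w" "Inr v" "Inr v'"] by simp
  show "w = w'" if "(w, v) \<in> restrict_right S" "(w', v) \<in> restrict_right S" for w w' v
    using that state_triangle_unique[OF S, of "Inr w" "Inr v" "Inr w'"] by simp
qed

lemma join_state:
  assumes s: "s \<in> states X" and s': "s' \<in> states Y"
  shows "map_prod Inl Inl ` s \<union> map_prod Inr Inr ` s' \<in> states Z" (is "?S \<in> _")
proof (rule stateI)
  fix a x assume "(a, x) \<in> ?S"
  then consider w v where "a = Inl w" "x = Inl v" "(w, v) \<in> s"
    | w v where "a = Inr w" "x = Inr v" "(w, v) \<in> s'" by auto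
  then have "a \<in> white_triangles Z - set_option (outer Z) \<and> x \<in> vertices Z - roots Z \<and> (\<exists>c. x = corner Z a c)"
  proof cases
    case 1
    then show ?thesis
      using state_pairD[OF s 1(3)] unfolding matched_triangles_Z matched_vertices_Z by auto
  next
    case 2
    then show ?thesis
      using state_pairD[OF s' 2(3)] unfolding matched_triangles_Z matched_vertices_Z
      by (auto simp: corner_Inr)
  qed
  then show "a \<in> white_triangles Z - set_option (outer Z)" "x \<in> vertices Z - roots Z" "\<exists>c. x = corner Z a c"
    by blast+
next
  fix a assume "a \<in> white_triangles Z - set_option (outer Z)"
  then show "\<exists>x. (a, x) \<in> ?S"
    unfolding matched_triangles_Z using state_ex_vertex[OF s] state_ex_vertex[OF s'] by force
next
  fix x assume "x \<in> vertices Z - roots Z"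
  then show "\<exists>a. (a, x) \<in> ?S"
    unfolding matched_vertices_Z using state_ex_triangle[OF s] state_ex_triangle[OF s'] by force
next
  show "x = x'" if "(a, x) \<in> ?S" "(a, x') \<in> ?S" for a x x'
    using that state_vertex_unique[OF s] state_vertex_unique[OF s'] by auto
  show "a = a'" if "(a, x) \<in> ?S" "(a', x) \<in> ?S" for a a' x
    using that state_triangle_unique[OF s] state_triangle_unique[OF s'] by auto
qed

lemma states_bij:
  "bij_betw (\<lambda>S. (restrict_left S, restrict_right S)) (states Z) (states X \<times> states Y)"
  by (rule bij_betwI[where g = "\<lambda>(s, s'). map_prod Inl Inl ` s \<union> map_prod Inr Inr ` s'"])
    (use restrict_left_state restrict_right_state join_state restrict_join state_decompose in auto)

text \<open>A matched pair lies in one summand. \<open>W i\<close> is paired with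
  \<open>u (Suc i mod 3)\<close> before the move and with \<open>u i\<close> after it, so
  consecutive vertices lie in the same summand, and hence all three do.\<close>

lemma clock_disk_sides:
  assumes S: "S \<in> states Z" and S': "S' \<in> states Z"
    and cw: "cw_pairs u W \<subseteq> S" and ccw: "ccw_pairs u W \<subseteq> S'"
  shows "(\<forall>i<3. isl (u i) \<and> isl (W i)) \<or> (\<forall>i<3. \<not> isl (u i) \<and> \<not> isl (W i))"
proof -
  have same: "isl a \<longleftrightarrow> isl x" if "M \<in> states Z" "(a, x) \<in> M" for M a x
    using that by (cases rule: state_pair_cases) auto
  have W: "isl (W i) \<longleftrightarrow> isl (u (Suc i mod 3))" "isl (W i) \<longleftrightarrow> isl (u i)" if "i < 3" for i
  proof -
    have "(W i, u (Suc i mod 3)) \<in> S" using cw that by (auto simp: cw_pairs_def)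
    then show "isl (W i) \<longleftrightarrow> isl (u (Suc i mod 3))" by (rule same[OF S])
    have "(W i, u i) \<in> S'" using ccw that by (auto simp: ccw_pairs_def)
    then show "isl (W i) \<longleftrightarrow> isl (u i)" by (rule same[OF S'])
  qed
  have "isl (u i) \<longleftrightarrow> isl (u 0)" if "i < 3" for i
  proof -
    have "i = 0 \<or> i = 1 \<or> i = 2" using that by linarith
    then show ?thesis using W[of 0] W[of 1] by (auto simp: numeral_2_eq_2)
  qed
  then show ?thesis using W(2) by blast
qed

section \<open>Clock moves of the sum and of its summands\<close>

lemma decompose_update:
  assumes "S \<in> states Z"
  shows "S - map_prod Inl Inl ` P \<union> map_prod Inl Inl ` Q =
      map_prod Inl Inl ` (restrict_left S - P \<union> Q) \<union> map_prod Inr Inr ` restrict_right S"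
    and "S - map_prod Inr Inr ` P' \<union> map_prod Inr Inr ` Q' =
      map_prod Inl Inl ` restrict_left S \<union> map_prod Inr Inr ` (restrict_right S - P' \<union> Q')"
proof -
  have inj: "inj (map_prod Inl Inl :: 't \<times> 'v \<Rightarrow> ('t + 'a) \<times> ('v + 'b))"
    "inj (map_prod Inr Inr :: 'a \<times> 'b \<Rightarrow> ('t + 'a) \<times> ('v + 'b))"
    by (auto intro!: prod.inj_map)
  have disj: "map_prod Inl Inl ` A \<inter> map_prod Inr Inr ` C = {}"
    for A :: "('t \<times> 'v) set" and C :: "('a \<times> 'b) set" by auto
  show "S - map_prod Inl Inl ` P \<union> map_prod Inl Inl ` Q =
      map_prod Inl Inl ` (restrict_left S - P \<union> Q) \<union> map_prod Inr Inr ` restrict_right S"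
    using disj[of P "restrict_right S"] by (subst state_decompose[OF assms]) (auto simp: image_Un image_set_diff[OF inj(1)])
  show "S - map_prod Inr Inr ` P' \<union> map_prod Inr Inr ` Q' =
      map_prod Inl Inl ` restrict_left S \<union> map_prod Inr Inr ` (restrict_right S - P' \<union> Q')"
    using disj[of "restrict_left S" P'] by (subst state_decompose[OF assms]) (auto simp: image_Un image_set_diff[OF inj(2)])
qed

text \<open>No \<open>W i\<close> is \<open>\<Delta>\<close>, since they are white. The disk may
  contain \<open>\<Delta>\<close>; then it absorbs the whole block, which has Euler characteristic
  1.\<close>

lemma move_left:
  assumes S: "S \<in> states Z" and S': "S' \<in> states Z"
    and eq: "restrict_right S = restrict_right S'"
    and mv: "clockwise_move X (restrict_left S) (restrict_left S')"
  shows "clockwise_move Z S S'"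
proof -
  from mv obtain D u W where cd: "clock_disk X D u W" and cw: "cw_pairs u W \<subseteq> restrict_left S"
    and upd: "restrict_left S' = restrict_left S - cw_pairs u W \<union> ccw_pairs u W"
    unfolding clockwise_move_def by blast
  have "W i \<noteq> \<Delta>" if "i < 3" for i
    using clock_diskE[OF cd] that X.white_not_black \<Delta>_black by metis
  then have disk: "clock_disk Z (left.lift D) (Inl \<circ> u) (Inl \<circ> W)"
    using left.clock_disk_lift[OF cd] euler_char_right_block by blast
  have pairs: "cw_pairs (Inl \<circ> u) (Inl \<circ> W) = map_prod Inl Inl ` cw_pairs u W"
    "ccw_pairs (Inl \<circ> u) (Inl \<circ> W) = map_prod Inl Inl ` ccw_pairs u W"
    by (auto intro!: cw_pairs_map_prod ccw_pairs_map_prod)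
  have "map_prod Inl Inl ` cw_pairs u W \<subseteq> S"
    using cw by auto
  moreover have "S' = S - map_prod Inl Inl ` cw_pairs u W \<union> map_prod Inl Inl ` ccw_pairs u W"
    using state_decompose[OF S'] decompose_update(1)[OF S] eq upd by simp
  ultimately show ?thesis
    unfolding clockwise_move_def using S S' disk pairs by metis
qed

text \<open>The disk avoids \<open>\<omega>\<close>, so nothing of \<open>X\<close> is absorbed. The
  pairs of the target state show that each \<open>W i\<close> differs from \<open>\<omega>\<close>
  and each \<open>u i\<close> is no root, so that \<open>join_vertex\<close> acts on them as
  \<open>Inr\<close>.\<close>

lemma move_right:
  assumes S: "S \<in> states Z" and S': "S' \<in> states Z"
    and eq: "restrict_left S = restrict_left S'"
    and mv: "clockwise_move Y (restrict_right S) (restrict_right S')"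
  shows "clockwise_move Z S S'"
proof -
  from mv obtain D u W where cd: "clock_disk Y D u W" and cw: "cw_pairs u W \<subseteq> restrict_right S"
    and upd: "restrict_right S' = restrict_right S - cw_pairs u W \<union> ccw_pairs u W"
    unfolding clockwise_move_def by blast
  have "\<omega> \<notin> D"
    by (rule Y.clock_disk_avoids_outer[OF outer_Y restrict_right_state[OF S] cd cw])
  have "(W i, u i) \<in> restrict_right S'" if "i < 3" for i
    using upd that by (auto simp: ccw_pairs_def)
  then have Wu: "W i \<noteq> \<omega>" "u i \<notin> roots Y" if "i < 3" for i
    using that state_pairD(1,2)[OF restrict_right_state[OF S']] outer_Y by fastforce+
  have disk: "clock_disk Z (right.lift D) (join_vertex \<circ> u) (Inr \<circ> W)"
    using right.clock_disk_lift[OF cd] Wu(1) \<open>\<omega> \<notin> D\<close> by blast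
  have pairs: "cw_pairs (join_vertex \<circ> u) (Inr \<circ> W) = map_prod Inr Inr ` cw_pairs u W"
    "ccw_pairs (join_vertex \<circ> u) (Inr \<circ> W) = map_prod Inr Inr ` ccw_pairs u W"
    using Wu(2) by (auto intro!: cw_pairs_map_prod ccw_pairs_map_prod simp: join_vertex_def)
  have "map_prod Inr Inr ` cw_pairs u W \<subseteq> S"
    using cw by auto
  moreover have "S' = S - map_prod Inr Inr ` cw_pairs u W \<union> map_prod Inr Inr ` ccw_pairs u W"
    using state_decompose[OF S'] decompose_update(2)[OF S] eq upd by simp
  ultimately show ?thesis
    unfolding clockwise_move_def using S S' disk pairs by metis
qed

lemma move_cases:
  assumes \<chi>: "euler_char X (triangles X) = 2 \<or> euler_char X (triangles X) = 0"
    and mv: "clockwise_move Z S S'"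
  shows "(restrict_right S = restrict_right S' \<and> clockwise_move X (restrict_left S) (restrict_left S')) \<or>
    (restrict_left S = restrict_left S' \<and> clockwise_move Y (restrict_right S) (restrict_right S'))"
proof -
  from mv obtain D u W where S: "S \<in> states Z" and S': "S' \<in> states Z"
    and cd: "clock_disk Z D u W" and cw: "cw_pairs u W \<subseteq> S"
    and upd: "S' = S - cw_pairs u W \<union> ccw_pairs u W"
    unfolding clockwise_move_def by blast
  have "euler_char Z D = 1" using cd by (simp add: clock_disk_def)
  have "ccw_pairs u W \<subseteq> S'" using upd by blast
  then consider (left) "\<forall>i<3. isl (u i) \<and> isl (W i)" | (right) "\<forall>i<3. \<not> isl (u i) \<and> \<not> isl (W i)"
    using clock_disk_sides[OF S S' cw] by blast
  then show ?thesis
  proof cases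
    case left
    then have "W i \<notin> Inr ` (triangles Y - {\<omega>})" if "i < 3" for i using that by auto
    then obtain D' u' W' where D': "D' \<subseteq> triangles X" "D = left.lift D'"
      and uW: "\<And>i. i < 3 \<Longrightarrow> u i = Inl (u' i)" "\<And>i. i < 3 \<Longrightarrow> W i = Inl (W' i)"
      and disk: "euler_char X D' = 1 \<Longrightarrow> clock_disk X D' u' W'"
      using left.clock_disk_descend[OF cd] by metis
    have "euler_char X D' = 1"
      using left.euler_char_lift[OF D'(1)] euler_char_right_block \<open>euler_char Z D = 1\<close> D'(2)
      by (simp split: if_splits)
    have pairs: "cw_pairs u W = map_prod Inl Inl ` cw_pairs u' W'" "ccw_pairs u W = map_prod Inl Inl ` ccw_pairs u' W'"
      by (rule cw_pairs_map_prod ccw_pairs_map_prod; simp add: uW)+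
    have "restrict_left S' = restrict_left S - cw_pairs u' W' \<union> ccw_pairs u' W'" "restrict_right S = restrict_right S'"
      unfolding upd pairs restrict_update_left by simp_all
    moreover have "cw_pairs u' W' \<subseteq> restrict_left S"
      using cw unfolding pairs by (auto simp: restrict_left_def)
    ultimately show ?thesis
      using disk[OF \<open>euler_char X D' = 1\<close>] restrict_left_state[OF S] restrict_left_state[OF S']
      unfolding clockwise_move_def by blast
  next
    case right
    then have "W i \<notin> Inl ` (triangles X - {\<Delta>})" if "i < 3" for i using that by auto
    then obtain D' u' W' where D': "D' \<subseteq> triangles Y" "edge_connected Y D'" "D = right.lift D'"
      and uW0: "\<And>i. i < 3 \<Longrightarrow> u i = join_vertex (u' i)" and W: "\<And>i. i < 3 \<Longrightarrow> W i = Inr (W' i)"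
      and disk: "euler_char Y D' = 1 \<Longrightarrow> clock_disk Y D' u' W'"
      using right.clock_disk_descend[OF cd] by metis
    \<comment> \<open>A root would be sent by \<open>join_vertex\<close> to the left
      summand.\<close>
    have u: "u i = Inr (u' i)" if "i < 3" for i
      using uW0[OF that] right that by (auto simp: join_vertex_def split: if_splits)
    \<comment> \<open>Removing \<open>\<Delta>\<close> from \<open>X\<close> costs 1 and
      \<open>euler_char_lift\<close> subtracts another 1: the correction is 0 for a sphere and -2
      for a torus.\<close>
    have \<chi>': "1 = euler_char Y D' + (if \<omega> \<in> D' then euler_char X (triangles X) - 2 else 0)"
      using right.euler_char_lift[OF D'(1)] euler_char_left_block \<open>euler_char Z D = 1\<close> D'(3)
      by (simp split: if_splits)
    have "euler_char Y D' = 1"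
    proof (cases "\<omega> \<in> D' \<and> euler_char X (triangles X) = 0")
      case True
      then have "euler_char Y D' = 3" using \<chi>' by simp
      moreover have "euler_char Y D' \<le> 2" using Y.euler_char_le_2[OF D'(1,2)] True by blast
      ultimately show ?thesis by simp
    next
      case False
      then show ?thesis using \<chi> \<chi>' by (auto split: if_splits)
    qed
    have pairs: "cw_pairs u W = map_prod Inr Inr ` cw_pairs u' W'" "ccw_pairs u W = map_prod Inr Inr ` ccw_pairs u' W'"
      by (rule cw_pairs_map_prod ccw_pairs_map_prod; simp add: u W)+
    have "restrict_right S' = restrict_right S - cw_pairs u' W' \<union> ccw_pairs u' W'" "restrict_left S = restrict_left S'"
      unfolding upd pairs restrict_update_right by simp_all
    moreover have "cw_pairs u' W' \<subseteq> restrict_right S"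
      using cw unfolding pairs by (auto simp: restrict_right_def)
    ultimately show ?thesis
      using disk[OF \<open>euler_char Y D' = 1\<close>] restrict_right_state[OF S] restrict_right_state[OF S']
      unfolding clockwise_move_def by blast
  qed
qed

end

section \<open>Isomorphism of the transition graphs\<close>

lemma digraph_iso_with_projI:
  assumes bij: "bij_betw f (pverts G) (pverts H)"
    and arcs: "\<And>x y. (x, y) \<in> parcs G \<Longrightarrow> x \<in> pverts G \<and> y \<in> pverts G"
    and arcs': "\<And>x y. (x, y) \<in> parcs H \<Longrightarrow> x \<in> pverts H \<and> y \<in> pverts H"
    and iff: "\<And>x y. x \<in> pverts G \<Longrightarrow> y \<in> pverts G \<Longrightarrow> (x, y) \<in> parcs G \<longleftrightarrow> (f x, f y) \<in> parcs H"
  shows "digraph_iso (with_proj G) (with_proj H)"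
  unfolding digraph_iso_def
proof (intro exI conjI)
  \<comment> \<open>Arcs are pairs of vertices, so the map on vertices determines the map on arcs,
    and tail and head remain the projections.\<close>
  let ?h = "\<lparr>iso_verts = f, iso_arcs = map_prod f f, iso_head = snd, iso_tail = fst\<rparr>"
  have inj: "inj_on f (pverts G)" using bij by (rule bij_betw_imp_inj_on)
  have sub: "parcs G \<subseteq> pverts G \<times> pverts G" using arcs by auto
  have "wf_digraph (with_proj G)" by unfold_locales (use sub in auto)
  moreover have "inj_on (map_prod f f) (parcs G)"
    using map_prod_inj_on[OF inj inj] sub by (rule inj_on_subset)
  ultimately show "pre_digraph.digraph_isomorphism (with_proj G) ?h"
    unfolding pre_digraph.digraph_isomorphism_def using inj by simp
  have "parcs H = map_prod f f ` parcs G"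
  proof (intro equalityI subrelI)
    fix a b assume ab: "(a, b) \<in> parcs H"
    then obtain x y where "x \<in> pverts G" "y \<in> pverts G" "a = f x" "b = f y"
      using arcs'[OF ab] bij_betw_imp_surj_on[OF bij] by blast
    then show "(a, b) \<in> map_prod f f ` parcs G" using iff[of x y] ab by force
  next
    fix a b assume "(a, b) \<in> map_prod f f ` parcs G"
    then show "(a, b) \<in> parcs H" using iff arcs by auto
  qed
  then show "with_proj H = app_iso ?h (with_proj G)"
    using bij by (simp add: with_proj_def app_iso_def bij_betw_def)
qed

theorem theorem2p4:
  fixes T :: "('t, 'v) trinity_data" and \<Delta> :: 't and T\<^sub>0 :: "('a, 'b) trinity_data"
  assumes "planar_trinity T \<or> toric_trinity T"
    and "\<Delta> \<in> black_triangles T"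
    and "planar_trinity T\<^sub>0"
  shows "(\<forall>S \<in> states (conn_sum T \<Delta> T\<^sub>0).
            restrict_left S \<in> states T \<and> restrict_right S \<in> states T\<^sub>0 \<and>
            S = map_prod Inl Inl ` restrict_left S \<union> map_prod Inr Inr ` restrict_right S) \<and>
         bij_betw (\<lambda>S. (restrict_left S, restrict_right S))
           (states (conn_sum T \<Delta> T\<^sub>0)) (states T \<times> states T\<^sub>0) \<and>
         (\<forall>S \<in> states (conn_sum T \<Delta> T\<^sub>0). \<forall>S' \<in> states (conn_sum T \<Delta> T\<^sub>0).
            clockwise_move (conn_sum T \<Delta> T\<^sub>0) S S' \<longleftrightarrow>
              (restrict_right S = restrict_right S' \<and>
                 clockwise_move T (restrict_left S) (restrict_left S')) \<or>
              (restrict_left S = restrict_left S' \<and>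
                 clockwise_move T\<^sub>0 (restrict_right S) (restrict_right S'))) \<and>
         digraph_iso (with_proj (transition_graph (conn_sum T \<Delta> T\<^sub>0)))
           (with_proj (cartesian_product (transition_graph T) (transition_graph T\<^sub>0)))"
proof -
  interpret Y: planar_trinity T\<^sub>0 by (rule assms)
  have "trinity T"
    using assms(1) by (auto simp: planar_trinity_def toric_trinity_def)
  moreover have "set_option (outer T) \<subseteq> white_triangles T"
    using assms(1) by (auto simp: planar_trinity_def planar_trinity_axioms_def
      toric_trinity_def toric_trinity_axioms_def)
  moreover have \<chi>: "euler_char T (triangles T) = 2 \<or> euler_char T (triangles T) = 0"
    using assms(1) by (auto simp: planar_trinity_def planar_trinity_axioms_def
      toric_trinity_def toric_trinity_axioms_def)
  moreover obtain \<omega> where "outer T\<^sub>0 = Some \<omega>" using Y.outer_white by blast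
  ultimately interpret connected_sum T T\<^sub>0 \<Delta> \<omega>
    using assms by (simp add: connected_sum_def connected_sum_axioms_def)
  have moves: "clockwise_move Z S S' \<longleftrightarrow>
      (restrict_right S = restrict_right S' \<and> clockwise_move T (restrict_left S) (restrict_left S')) \<or>
      (restrict_left S = restrict_left S' \<and> clockwise_move T\<^sub>0 (restrict_right S) (restrict_right S'))"
    if "S \<in> states Z" "S' \<in> states Z" for S S'
    using move_cases[OF \<chi>] move_left move_right that by blast
  have "digraph_iso (with_proj (transition_graph Z))
      (with_proj (cartesian_product (transition_graph T) (transition_graph T\<^sub>0)))"
  proof (rule digraph_iso_with_projI)
    show "bij_betw (\<lambda>S. (restrict_left S, restrict_right S)) (pverts (transition_graph Z))
        (pverts (cartesian_product (transition_graph T) (transition_graph T\<^sub>0)))"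
      using states_bij by (simp add: transition_graph_def cartesian_product_def)
  next
    fix S S' assume "S \<in> pverts (transition_graph Z)" "S' \<in> pverts (transition_graph Z)"
    then show "(S, S') \<in> parcs (transition_graph Z) \<longleftrightarrow>
        ((restrict_left S, restrict_right S), (restrict_left S', restrict_right S'))
          \<in> parcs (cartesian_product (transition_graph T) (transition_graph T\<^sub>0))"
      using moves[of S S'] restrict_left_state[of S] restrict_right_state[of S]
      by (auto simp: transition_graph_def cartesian_product_def)
  qed (auto simp: transition_graph_def cartesian_product_def clockwise_move_def)
  then show ?thesis
    using restrict_left_state restrict_right_state state_decompose states_bij moves by blast
qed

end
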